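(* Fix $\varepsilon\in(0,\varepsilon_{\max})$ and write $\Omega=\Omega_\varepsilon$, $\mathbf B=\mathbf B_\varepsilon$, $w_L=w_L(\cdot;\varepsilon)$, $\lambda_L=\lambda_L(\cdot;\varepsilon)$. Let $f$ satisfy the regularity condition stated in the context. Suppose that $$(1+|w_L(t)-g(t)|)\exp\Big(\int_{t_0}^{t}\lambda_L(\tau)\,d\tau\Big)\to0\quad\text{as }t\to+\infty,\qquad t_0\in\mathbb R,$$ but that the condition $$\int_v^{+\infty} f'(\tau)\exp\Big(\int_v^\tau\lambda_L(s)\,ds\Big)d\tau<+\infty\quad\text{for all }v\in\mathbb R$$ fails. Then $\mathbf B(x;f)=+\infty$ for every $x\in\Omega\setminus\partial_{\rm fixed}\Omega$.
   Context: Domains. Let $0<\varepsilon_{\max}\le\infty$ and let $\mathbf g(\cdot;\varepsilon)=(\mathbf g_1,\mathbf g_2):\mathbb R\to\mathbb R^2$, $0\le\varepsilon<\varepsilon_{\max}$, be $C^3$ curves, $C^{3,1}$-smooth in $(t,\varepsilon)$ (the mixed derivative $\partial_t^3\partial_\varepsilon\mathbf g$ is continuous), such that for every $\varepsilon$ (primes denote $\partial_t$) $\mathbf g_1'>0$ and $\mathbf g_2''\mathbf g_1'-\mathbf g_2'\mathbf g_1''>0$. Put $g(t)=(g_1(t),g_2(t))=\mathbf g(t;0)$ and $\Xi_\varepsilon=\{(\mathbf g_1(t;\varepsilon),x_2):t\in\mathbb R,\ x_2>\mathbf g_2(t;\varepsilon)\}$. Assume that for $\varepsilon_1<\varepsilon_2$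 one has $\Xi_{\varepsilon_1}\supset\Xi_{\varepsilon_2}$ and $\mathbf g(t;\varepsilon_1)\notin\overline{\Xi_{\varepsilon_2}}$ for all $t$. Assume that for every $\varepsilon\in(0,\varepsilon_{\max})$ and $t\in\mathbb R$ there are two tangent lines from $g(t)$ to $\Xi_\varepsilon$, each meeting the curve $g(\cdot)$ twice. Let $w_L(t;\varepsilon)=\mathbf g(s_L;\varepsilon)$ and $w_R(t;\varepsilon)=\mathbf g(s_R;\varepsilon)$, $s_R<s_L$, be the tangency points, $S_L(t;\varepsilon)=[g(t),w_L(t;\varepsilon)]$, $S_R(t;\varepsilon)=[g(t),w_R(t;\varepsilon)]$ the tangent segments, and $\kappa_L,\kappa_R$ their slopes; assume $\partial_\varepsilon\kappa_L\ne0$, $\partial_\varepsilon\kappa_R\neq 0$ everywhere. Let $T_\varepsilon(t)$ be the closed curvilinear triangle with vertex $g(t)$ bounded by $S_L(t;\varepsilon)$, $S_R(t;\varepsilon)$ and the arc of $\mathbf g(\cdot;\varepsilon)$ between the two tangency points, and $\Omega_\varepsilon=\bigcup_{t}T_\varepsilon(t)$. The fixed boundary is $\partial_{\rm fixed}\Omega_\varepsilon=g(\mathbb R)$. The scalar function $\lambda_L(t;\varepsilon)<0$ is defined by $\lambda_L(t)(g(t)-w_L(t))=w_L'(t)$. Regularity condition on $f:\mathbb R\to\mathbb R$: $f\in C^2(\mathbb R)$ and $\mathfrak K=\kappa_3'/\kappa_2'$ is piecewise monotone with finitely many monotonicity intervals, where $\kappa_2=g_2'/g_1'$, $\kappa_3=f'/g_1'$.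 (Then $f'$ has constant sign near $+\infty$.) Bellman function. For an interval $I$, $\mathbf A_{\Omega_\varepsilon}(I)$ is the class of summable $\varphi:I\to\partial_{\rm fixed}\Omega_\varepsilon$ with average $\langle\varphi\rangle_J\in\Omega_\varepsilon$ for every subinterval $J\subset I$. Let $\mathrm f(g(t))=f(t)$; $\mathbf B_\varepsilon(x;f)=\sup\{\langle \mathrm f(\varphi)\rangle_I:\ \langle\varphi\rangle_I=x,\ \varphi\in\mathbf A_{\Omega_\varepsilon}(I)\}$ (independent of $I$), the supremum being over those $\varphi$ for which the average makes sense in $[-\infty,+\infty]$. *)

theory Defs
  imports "HOL-Analysis.Analysis"
begin

text \<open>A family of plane curves is a function \<open>G :: real \<Rightarrow> real \<Rightarrow> real \<times> real\<close>, where \<open>G \<epsilon> t\<close> is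
  the point with parameter \<open>t\<close> on the curve number \<open>\<epsilon>\<close>; in particular \<open>G 0\<close> is the curve \<open>g\<close>.\<close>

definition eps_range :: "ereal \<Rightarrow> real set" where
  "eps_range \<epsilon>max = {\<epsilon>. 0 \<le> \<epsilon> \<and> ereal \<epsilon> < \<epsilon>max}"

text \<open>\<open>D i j \<epsilon> t\<close> is the derivative of order \<open>i\<close> in \<open>t\<close> and of order \<open>j\<close> in \<open>\<epsilon>\<close>.
  Derivatives in \<open>\<epsilon>\<close> are taken within \<open>E\<close>, hence one-sided at \<open>\<epsilon> = 0\<close>.\<close>

definition C31_smooth :: "real set \<Rightarrow> (real \<Rightarrow> real \<Rightarrow> real \<times> real) \<Rightarrow> bool" where
  "C31_smooth E G \<longleftrightarrow>
    (\<exists>D :: nat \<Rightarrow> nat \<Rightarrow> real \<Rightarrow> real \<Rightarrow> real \<times> real.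
      (\<forall>\<epsilon>\<in>E. \<forall>t. D 0 0 \<epsilon> t = G \<epsilon> t) \<and>
      (\<forall>i<3. \<forall>j\<le>1. \<forall>\<epsilon>\<in>E. \<forall>t. (D i j \<epsilon> has_vector_derivative D (Suc i) j \<epsilon> t) (at t)) \<and>
      (\<forall>i\<le>3. \<forall>\<epsilon>\<in>E. \<forall>t. ((\<lambda>h. D i 0 h t) has_vector_derivative D i 1 \<epsilon> t) (at \<epsilon> within E)) \<and>
      (\<forall>i\<le>3. \<forall>j\<le>1. continuous_on (E \<times> UNIV) (\<lambda>(\<epsilon>, t). D i j \<epsilon> t)))"

definition convex_graph_curve :: "(real \<Rightarrow> real \<times> real) \<Rightarrow> bool" where
  "convex_graph_curve \<gamma> \<longleftrightarrow>
    (let \<gamma>1 = (\<lambda>t. fst (\<gamma> t)); \<gamma>2 = (\<lambda>t. snd (\<gamma> t)) in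
      \<forall>t. deriv \<gamma>1 t > 0 \<and>
          deriv (deriv \<gamma>2) t * deriv \<gamma>1 t - deriv \<gamma>2 t * deriv (deriv \<gamma>1) t > 0)"

definition Xi :: "(real \<Rightarrow> real \<Rightarrow> real \<times> real) \<Rightarrow> real \<Rightarrow> (real \<times> real) set" where
  "Xi G \<epsilon> = {(fst (G \<epsilon> t), y) | t y. y > snd (G \<epsilon> t)}"

definition tangent_line :: "(real \<Rightarrow> real \<times> real) \<Rightarrow> real \<Rightarrow> (real \<times> real) set" where
  "tangent_line \<gamma> s = {\<gamma> s + r *\<^sub>R vector_derivative \<gamma> (at s) | r. True}"

text \<open>Parameters of the points where the tangent lines from \<open>G 0 t\<close> touch the curve \<open>G \<epsilon>\<close>.
  Under \<open>convex_graph_curve (G \<epsilon>)\<close> the slope of the tangent is strictly monotone in the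
  parameter, so these parameters correspond one-to-one to the tangent lines.\<close>

definition tangency_params :: "(real \<Rightarrow> real \<Rightarrow> real \<times> real) \<Rightarrow> real \<Rightarrow> real \<Rightarrow> real set" where
  "tangency_params G \<epsilon> t = {s. G 0 t \<in> tangent_line (G \<epsilon>) s}"

definition s_L :: "(real \<Rightarrow> real \<Rightarrow> real \<times> real) \<Rightarrow> real \<Rightarrow> real \<Rightarrow> real" where
  "s_L G \<epsilon> t = Max (tangency_params G \<epsilon> t)"

definition s_R :: "(real \<Rightarrow> real \<Rightarrow> real \<times> real) \<Rightarrow> real \<Rightarrow> real \<Rightarrow> real" where
  "s_R G \<epsilon> t = Min (tangency_params G \<epsilon> t)"

definition w_L :: "(real \<Rightarrow> real \<Rightarrow> real \<times> real) \<Rightarrow> real \<Rightarrow> real \<Rightarrow> real \<times> real" where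
  "w_L G \<epsilon> t = G \<epsilon> (s_L G \<epsilon> t)"

definition w_R :: "(real \<Rightarrow> real \<Rightarrow> real \<times> real) \<Rightarrow> real \<Rightarrow> real \<Rightarrow> real \<times> real" where
  "w_R G \<epsilon> t = G \<epsilon> (s_R G \<epsilon> t)"

definition S_L :: "(real \<Rightarrow> real \<Rightarrow> real \<times> real) \<Rightarrow> real \<Rightarrow> real \<Rightarrow> (real \<times> real) set" where
  "S_L G \<epsilon> t = closed_segment (G 0 t) (w_L G \<epsilon> t)"

definition S_R :: "(real \<Rightarrow> real \<Rightarrow> real \<times> real) \<Rightarrow> real \<Rightarrow> real \<Rightarrow> (real \<times> real) set" where
  "S_R G \<epsilon> t = closed_segment (G 0 t) (w_R G \<epsilon> t)"

definition slope :: "real \<times> real \<Rightarrow> real \<times> real \<Rightarrow> real" where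
  "slope p q = (snd q - snd p) / (fst q - fst p)"

definition kappa_L :: "(real \<Rightarrow> real \<Rightarrow> real \<times> real) \<Rightarrow> real \<Rightarrow> real \<Rightarrow> real" where
  "kappa_L G \<epsilon> t = slope (G 0 t) (w_L G \<epsilon> t)"

definition kappa_R :: "(real \<Rightarrow> real \<Rightarrow> real \<times> real) \<Rightarrow> real \<Rightarrow> real \<Rightarrow> real" where
  "kappa_R G \<epsilon> t = slope (G 0 t) (w_R G \<epsilon> t)"

text \<open>The derivative of \<open>w_L\<close> is taken in the parameter \<open>t\<close> of the curve \<open>G 0\<close>.\<close>

definition lambda_L :: "(real \<Rightarrow> real \<Rightarrow> real \<times> real) \<Rightarrow> real \<Rightarrow> real \<Rightarrow> real" where
  "lambda_L G \<epsilon> t =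
    (THE l. l *\<^sub>R (G 0 t - w_L G \<epsilon> t) = vector_derivative (w_L G \<epsilon>) (at t))"

definition tangency_arc :: "(real \<Rightarrow> real \<Rightarrow> real \<times> real) \<Rightarrow> real \<Rightarrow> real \<Rightarrow> (real \<times> real) set" where
  "tangency_arc G \<epsilon> t = G \<epsilon> ` {s_R G \<epsilon> t .. s_L G \<epsilon> t}"

text \<open>The two tangent segments together, and the arc above them, are graphs over the same interval
  of the first coordinate. The closed region they bound consists of the points lying
  vertically between them.\<close>

definition curv_triangle :: "(real \<Rightarrow> real \<Rightarrow> real \<times> real) \<Rightarrow> real \<Rightarrow> real \<Rightarrow> (real \<times> real) set" where
  "curv_triangle G \<epsilon> t =
    {(x, y). \<exists>lo hi. (x, lo) \<in> S_L G \<epsilon> t \<union> S_R G \<epsilon> t \<and> (x, hi) \<in> tangency_arc G \<epsilon> t \<and> lo \<le> y \<and> y \<le> hi}"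

definition Omega :: "(real \<Rightarrow> real \<Rightarrow> real \<times> real) \<Rightarrow> real \<Rightarrow> (real \<times> real) set" where
  "Omega G \<epsilon> = (\<Union>t. curv_triangle G \<epsilon> t)"

definition fixed_bdry :: "(real \<Rightarrow> real \<Rightarrow> real \<times> real) \<Rightarrow> (real \<times> real) set" where
  "fixed_bdry G = range (G 0)"

definition admissible_family :: "ereal \<Rightarrow> (real \<Rightarrow> real \<Rightarrow> real \<times> real) \<Rightarrow> bool" where
  "admissible_family \<epsilon>max G \<longleftrightarrow>
    0 < \<epsilon>max \<and>
    C31_smooth (eps_range \<epsilon>max) G \<and>
    (\<forall>\<epsilon>\<in>eps_range \<epsilon>max. convex_graph_curve (G \<epsilon>)) \<and>
    (\<forall>\<epsilon>1\<in>eps_range \<epsilon>max. \<forall>\<epsilon>2\<in>eps_range \<epsilon>max. \<epsilon>1 < \<epsilon>2 \<longrightarrow>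
      Xi G \<epsilon>2 \<subseteq> Xi G \<epsilon>1 \<and> (\<forall>t. G \<epsilon>1 t \<notin> closure (Xi G \<epsilon>2))) \<and>
    (\<forall>\<epsilon>\<in>eps_range \<epsilon>max. 0 < \<epsilon> \<longrightarrow> (\<forall>t.
      card (tangency_params G \<epsilon> t) = 2 \<and>
      (\<forall>s\<in>tangency_params G \<epsilon> t. card (tangent_line (G \<epsilon>) s \<inter> range (G 0)) = 2) \<and>
      (\<exists>D. ((\<lambda>h. kappa_L G h t) has_real_derivative D) (at \<epsilon>) \<and> D \<noteq> 0) \<and>
      (\<exists>D. ((\<lambda>h. kappa_R G h t) has_real_derivative D) (at \<epsilon>) \<and> D \<noteq> 0)))"

definition piecewise_monotone :: "(real \<Rightarrow> real) \<Rightarrow> bool" where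
  "piecewise_monotone K \<longleftrightarrow>
    (\<exists>P. finite P \<and> \<Union>P = UNIV \<and>
      (\<forall>I\<in>P. is_interval I \<and> (mono_on I K \<or> monotone_on I (\<le>) (\<ge>) K)))"

definition regular_function :: "(real \<Rightarrow> real \<times> real) \<Rightarrow> (real \<Rightarrow> real) \<Rightarrow> bool" where
  "regular_function g f \<longleftrightarrow>
    f C1_differentiable_on UNIV \<and> deriv f C1_differentiable_on UNIV \<and>
    (let g1 = (\<lambda>t. fst (g t)); g2 = (\<lambda>t. snd (g t));
         \<kappa>2 = (\<lambda>t. deriv g2 t / deriv g1 t);
         \<kappa>3 = (\<lambda>t. deriv f t / deriv g1 t)
     in piecewise_monotone (\<lambda>t. deriv \<kappa>3 t / deriv \<kappa>2 t))"

text \<open>The Lebesgue integral with values in the extended reals. It makes sense unless the positive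
  and the negative part both have infinite integral.\<close>

definition ext_integral_exists :: "real set \<Rightarrow> (real \<Rightarrow> real) \<Rightarrow> bool" where
  "ext_integral_exists A h \<longleftrightarrow>
    (\<integral>\<^sup>+ s\<in>A. ennreal (h s) \<partial>lebesgue) < \<infinity> \<or> (\<integral>\<^sup>+ s\<in>A. ennreal (- h s) \<partial>lebesgue) < \<infinity>"

definition ext_integral :: "real set \<Rightarrow> (real \<Rightarrow> real) \<Rightarrow> ereal" where
  "ext_integral A h =
    enn2ereal (\<integral>\<^sup>+ s\<in>A. ennreal (h s) \<partial>lebesgue) - enn2ereal (\<integral>\<^sup>+ s\<in>A. ennreal (- h s) \<partial>lebesgue)"

definition average :: "real \<Rightarrow> real \<Rightarrow> (real \<Rightarrow> real \<times> real) \<Rightarrow> real \<times> real" where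
  "average c d \<phi> = (1 / (d - c)) *\<^sub>R (LINT s:{c..d}|lebesgue. \<phi> s)"

definition A_class ::
    "(real \<Rightarrow> real \<Rightarrow> real \<times> real) \<Rightarrow> real \<Rightarrow> real \<Rightarrow> real \<Rightarrow> (real \<Rightarrow> real \<times> real) set" where
  "A_class G \<epsilon> a b =
    {\<phi>. \<phi> absolutely_integrable_on {a..b} \<and> \<phi> ` {a..b} \<subseteq> fixed_bdry G \<and>
        (\<forall>c d. a \<le> c \<and> c < d \<and> d \<le> b \<longrightarrow> average c d \<phi> \<in> Omega G \<epsilon>)}"

definition bdry_fun :: "(real \<Rightarrow> real \<times> real) \<Rightarrow> (real \<Rightarrow> real) \<Rightarrow> real \<times> real \<Rightarrow> real" where
  "bdry_fun g f p = f (inv g p)"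

text \<open>The Bellman function computed on the interval \<open>{a..b}\<close>.\<close>

definition Bellman ::
    "(real \<Rightarrow> real \<Rightarrow> real \<times> real) \<Rightarrow> real \<Rightarrow> (real \<Rightarrow> real) \<Rightarrow> real \<Rightarrow> real \<Rightarrow> real \<times> real \<Rightarrow> ereal" where
  "Bellman G \<epsilon> f a b x =
    Sup {ext_integral {a..b} (\<lambda>s. bdry_fun (G 0) f (\<phi> s)) / ereal (b - a) | \<phi>.
          \<phi> \<in> A_class G \<epsilon> a b \<and> average a b \<phi> = x \<and>
          ext_integral_exists {a..b} (\<lambda>s. bdry_fun (G 0) f (\<phi> s))}"

end

theory Submission
  imports Defs
begin

text \<open>
  Why the value is infinite. Fix a point \<open>g(u)\<close> of the lower curve and follow the left tangent
  segments \<open>[g(t), w(t)]\<close> for \<open>t \<ge> u\<close>. Since \<open>w' = \<lambda> (g - w)\<close> with \<open>\<lambda> < 0\<close>, the point \<open>w(t)\<close> is an average of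
  \<open>w(t + dt)\<close>, with weight \<open>1 - \<bar>\<lambda>\<bar> dt\<close>, and \<open>g(t)\<close>, with weight \<open>\<bar>\<lambda>\<bar> dt\<close>. Iterating this to infinity writes
  \<open>w(u)\<close> as the average over \<open>(0, 1]\<close> of the function \<open>\<phi>\<close> that takes the value \<open>g(t)\<close> at the point
  \<open>E(t) = exp (\<integral>\<^sub>u\<^sup>t \<lambda>)\<close>: the average over the initial interval \<open>(0, E(t)]\<close> is exactly \<open>w(t)\<close>. Letting \<open>\<phi>\<close>
  continue with the constant value \<open>g(u)\<close> moves its average along the segment \<open>[g(u), w(u)]\<close>, and every
  point of the domain off the lower curve lies on such a segment (\<open>domain_cases\<close>).

  The proof has four ingredients.

  \<^item> Summability of \<open>\<phi>\<close>. The first assumption says that \<open>E (w - g) \<longlonglongrightarrow> 0\<close> and \<open>E \<longlonglongrightarrow> 0\<close>; by l'Hopital's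
    rule then \<open>E w \<longlonglongrightarrow> 0\<close> (\<open>attracted_decay\<close>), so that nothing is lost at infinity and the averages of \<open>\<phi>\<close>
    are those just described (\<open>has_integral_comp_clock_start\<close>, \<open>initial_average\<close>).

  \<^item> Admissibility of \<open>\<phi>\<close>. The average over \<open>[c, d]\<close> lies on the line through the two averages over
    \<open>[0, c]\<close> and \<open>[0, d]\<close>, beyond the second one. As the left tangent turns from its position at the end
    of the interval to its position at the start, it sweeps over this average, which therefore belongs
    to one of the segments (\<open>beyond_chord_in_domain\<close>, \<open>average_in_domain\<close>).

  \<^item> The value. An integration by parts turns the integral of \<open>f\<close> along \<open>\<phi>\<close> into a constant plus
    \<open>\<integral> f' E\<close>. Since \<open>f'\<close> has a constant sign near infinity (\<open>regular_eventually_sign\<close>), the failure of the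
    second condition means that this integral diverges to \<open>+\<infinity>\<close> (\<open>value_diverges\<close>), while \<open>f\<close> is bounded below
    along \<open>\<phi>\<close>; so the average of \<open>f\<close> along \<open>\<phi>\<close> makes sense and is \<open>+\<infinity>\<close>
    (\<open>ext_integral_comp_clock_infinite\<close>).

  \<^item> The geometry of left tangents: the tangency parameter is a \<open>C\<^sup>1\<close> function of \<open>t\<close> with positive
    derivative (\<open>sL_deriv\<close>), hence \<open>\<lambda>\<close> is continuous and negative and \<open>w' = \<lambda> (g - w)\<close>.

  The geometric part is carried out in coordinates: \<open>(x, y)\<close> parametrises the lower curve, \<open>(X, Y)\<close> the upper
  one, and \<open>tan_at s p\<close> is the height at abscissa \<open>p\<close> of the tangent with parameter \<open>s\<close>.
\<close>

section \<open>Convex curves and their tangents\<close>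

lemma continuous_on_if_DERIV:
  fixes h :: "real \<Rightarrow> real"
  assumes "\<And>t. (h has_real_derivative h' t) (at t)" shows "continuous_on A h"
  using assms DERIV_isCont continuous_at_imp_continuous_on by blast

lemma continuous_on_atLeast_if_Icc:
  fixes h :: "real \<Rightarrow> real"
  assumes "\<And>w. continuous_on {u..w} h" shows "continuous_on {u..} h"
  unfolding continuous_on_eq_continuous_within
proof
  fix t assume "t \<in> {u..}"
  then have "continuous (at t within {u..t + 1}) h"
    using assms[of "t + 1"] by (auto simp: continuous_on_eq_continuous_within)
  moreover have "at t within {u..t + 1} = at t within {u..}"
    by (rule at_within_nhd[of _ "{..<t + 1}"]) auto
  ultimately show "continuous (at t within {u..}) h" by simp
qed

locale convex_curve =
  fixes x y x' y' x'' y'' :: "real \<Rightarrow> real"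
  assumes x_deriv: "(x has_real_derivative x' t) (at t)"
    and y_deriv: "(y has_real_derivative y' t) (at t)"
    and x'_deriv: "(x' has_real_derivative x'' t) (at t)"
    and y'_deriv: "(y' has_real_derivative y'' t) (at t)"
    and x''_cont: "continuous_on UNIV x''"
    and y''_cont: "continuous_on UNIV y''"
    and x'_pos: "x' t > 0"
    and curvature_pos: "y'' t * x' t - y' t * x'' t > 0"
begin

definition slope_at :: "real \<Rightarrow> real" where "slope_at t = y' t / x' t"

definition slope_at' :: "real \<Rightarrow> real" where
  "slope_at' t = (y'' t * x' t - y' t * x'' t) / (x' t)\<^sup>2"

definition tan_at :: "real \<Rightarrow> real \<Rightarrow> real" where
  "tan_at t p = y t + slope_at t * (p - x t)"

lemma slope_at_deriv: "(slope_at has_real_derivative slope_at' t) (at t)"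
  unfolding slope_at_def[abs_def] slope_at'_def
  by (rule derivative_eq_intros x'_deriv y'_deriv refl)+
     (use x'_pos[of t] in \<open>auto simp: power2_eq_square\<close>)

lemma slope_at'_pos: "slope_at' t > 0"
  unfolding slope_at'_def using curvature_pos x'_pos by (simp add: less_imp_neq[symmetric])

lemma slope_at_strict_mono: "strict_mono slope_at"
  by (rule strict_monoI, rule DERIV_pos_imp_increasing) (use slope_at_deriv slope_at'_pos in blast)+

lemma x_strict_mono: "strict_mono x"
  by (rule strict_monoI, rule DERIV_pos_imp_increasing) (use x_deriv x'_pos in blast)+

lemma cont: "continuous_on A x" "continuous_on A y" "continuous_on A x'" "continuous_on A y'"
    "continuous_on A slope_at"
  by (rule continuous_on_if_DERIV, rule x_deriv y_deriv x'_deriv y'_deriv slope_at_deriv)+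

lemma slope_at'_cont: "continuous_on UNIV slope_at'"
  unfolding slope_at'_def[abs_def]
  by (intro continuous_intros cont x''_cont y''_cont) (use x'_pos in \<open>auto simp: less_imp_neq[symmetric]\<close>)

lemma x_less_iff: "x s < x t \<longleftrightarrow> s < t" and x_le_iff: "x s \<le> x t \<longleftrightarrow> s \<le> t"
    and x_eq_iff: "x s = x t \<longleftrightarrow> s = t"
  using x_strict_mono by (auto simp: strict_mono_less strict_mono_less_eq strict_mono_eq)

lemma slope_at_less_iff: "slope_at s < slope_at t \<longleftrightarrow> s < t"
  using slope_at_strict_mono by (simp add: strict_mono_less)

lemma tan_at_deriv: "((\<lambda>s. tan_at s p) has_real_derivative slope_at' s * (p - x s)) (at s)"
  unfolding tan_at_def[abs_def]
  by (rule derivative_eq_intros x_deriv y_deriv slope_at_deriv refl)+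
     (use x'_pos[of s] in \<open>auto simp: slope_at_def\<close>)

lemma tan_at_cont: "continuous_on A (\<lambda>s. tan_at s p)"
  by (rule continuous_on_if_DERIV, rule tan_at_deriv)

text \<open>Seen from abscissa \<open>p\<close>, the height of the tangent grows as the point of contact moves towards \<open>p\<close>:
  its derivative in the contact parameter has the sign of \<open>p - x s\<close>.\<close>

lemma tan_at_increasing:
  assumes "s1 < s2" "x s2 \<le> p" shows "tan_at s1 p < tan_at s2 p"
proof (rule DERIV_pos_imp_increasing_open[OF assms(1)])
  fix s assume "s1 < s" "s < s2"
  then have "x s < p" using assms x_less_iff[of s s2] by linarith
  then show "\<exists>D. ((\<lambda>s. tan_at s p) has_real_derivative D) (at s) \<and> 0 < D"
    using tan_at_deriv[of p s] slope_at'_pos[of s] by (intro exI[of _ "slope_at' s * (p - x s)"]) auto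
next
  show "continuous_on {s1..s2} (\<lambda>s. tan_at s p)"
    by (rule tan_at_cont)
qed

lemma tan_at_decreasing:
  assumes "s1 < s2" "p \<le> x s1" shows "tan_at s2 p < tan_at s1 p"
proof (rule DERIV_neg_imp_decreasing_open[OF assms(1)])
  fix s assume "s1 < s" "s < s2"
  then have "p < x s" using assms x_less_iff[of s1 s] by linarith
  then show "\<exists>D. ((\<lambda>s. tan_at s p) has_real_derivative D) (at s) \<and> D < 0"
    using tan_at_deriv[of p s] slope_at'_pos[of s]
    by (intro exI[of _ "slope_at' s * (p - x s)"]) (auto simp: mult_pos_neg)
next
  show "continuous_on {s1..s2} (\<lambda>s. tan_at s p)"
    by (rule tan_at_cont)
qed

lemma tan_at_self [simp]: "tan_at s (x s) = y s"
  by (simp add: tan_at_def)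

text \<open>Strict convexity in the form in which it is used: the curve lies above its tangents. It follows from the
  monotonicity above by moving the point of contact to the point that is compared.\<close>

lemma tan_at_less: "s \<noteq> t \<Longrightarrow> tan_at t (x s) < y s"
  using tan_at_increasing[of t s "x s"] tan_at_decreasing[of s t "x s"] by (cases s t rule: linorder_cases) auto

lemma tan_at_le: "tan_at t (x s) \<le> y s"
  using tan_at_less[of s t] by (cases "s = t") auto

lemma x_IVT:
  assumes "x s \<le> p" "p \<le> x t" obtains r where "s \<le> r" "r \<le> t" "x r = p"
proof -
  have "s \<le> t" using assms x_le_iff order_trans by blast
  then show ?thesis using IVT'[of x s p t] assms cont(1) that by blast
qed

end

lemma (in convex_curve) vector_deriv: "((\<lambda>t. (x t, y t)) has_vector_derivative (x' s, y' s)) (at s)"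
  using x_deriv[of s] y_deriv[of s] unfolding has_real_derivative_iff_has_vector_derivative
  by (rule has_vector_derivative_Pair)

lemma (in convex_curve) tangent_line_eq: "(p, q) \<in> tangent_line (\<lambda>t. (x t, y t)) s \<longleftrightarrow> q = tan_at s p"
proof
  assume "(p, q) \<in> tangent_line (\<lambda>t. (x t, y t)) s"
  then obtain r where "p = x s + r * x' s" "q = y s + r * y' s"
    unfolding tangent_line_def vector_derivative_at[OF vector_deriv] by auto
  then show "q = tan_at s p"
    using x'_pos[of s] unfolding tan_at_def slope_at_def by simp
next
  assume "q = tan_at s p"
  then have "(p, q) = (x s, y s) + ((p - x s) / x' s) *\<^sub>R (x' s, y' s)"
    using x'_pos[of s] unfolding tan_at_def slope_at_def by simp
  then show "(p, q) \<in> tangent_line (\<lambda>t. (x t, y t)) s"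
    unfolding tangent_line_def vector_derivative_at[OF vector_deriv] by blast
qed

section \<open>The tangents from the lower curve\<close>

text \<open>The hypotheses on the two curves that remain for one value of the parameter: the upper curve runs strictly
  inside the epigraph of the lower one, and every point of the lower curve sends two tangents to the
  upper one, each of which meets the lower curve a second time.\<close>

locale tangent_domain =
  low: convex_curve x y x' y' x'' y'' + up: convex_curve X Y X' Y' X'' Y''
  for x y x' y' x'' y'' X Y X' Y' X'' Y'' :: "real \<Rightarrow> real" +
  assumes above: "\<exists>t. x t = X s \<and> y t < Y s"
    and two_tangents: "card {s. up.tan_at s (x t) = y t} = 2"
    and second_intersection: "up.tan_at s (x t) = y t \<Longrightarrow> \<exists>t'. t' \<noteq> t \<and> up.tan_at s (x t') = y t'"
begin

definition sL :: "real \<Rightarrow> real" where "sL t = Max {s. up.tan_at s (x t) = y t}"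
definition sR :: "real \<Rightarrow> real" where "sR t = Min {s. up.tan_at s (x t) = y t}"

lemma above_tangent: "low.tan_at t (X s) < Y s"
  using above[of s] low.tan_at_le[of t] by (metis le_less_trans)

lemma contact_off: "up.tan_at s (x t) = y t \<Longrightarrow> X s \<noteq> x t"
  using above[of s] up.tan_at_self[of s] by (metis low.x_eq_iff order_less_irrefl)

lemma contact_unique_right:
  assumes "up.tan_at s (x t) = y t" "up.tan_at r (x t) = y t" "x t < X s" "x t < X r"
  shows "s = r"
  using assms up.tan_at_decreasing[of s r "x t"] up.tan_at_decreasing[of r s "x t"]
  by (cases s r rule: linorder_cases) auto

lemma contact_unique_left:
  assumes "up.tan_at s (x t) = y t" "up.tan_at r (x t) = y t" "X s < x t" "X r < x t"
  shows "s = r"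
  using assms up.tan_at_increasing[of s r "x t"] up.tan_at_increasing[of r s "x t"]
  by (cases s r rule: linorder_cases) auto

lemma contacts: "{s. up.tan_at s (x t) = y t} = {sR t, sL t}" "sR t < sL t"
proof -
  obtain a b where "{s. up.tan_at s (x t) = y t} = {a, b}" "a \<noteq> b"
    using two_tangents[of t] by (auto simp: card_2_iff)
  then show "{s. up.tan_at s (x t) = y t} = {sR t, sL t}" "sR t < sL t"
    unfolding sL_def sR_def by (auto simp: min_def max_def)
qed

lemma sL_contact: "up.tan_at (sL t) (x t) = y t" and sR_contact: "up.tan_at (sR t) (x t) = y t"
  using contacts(1)[of t] by auto

text \<open>On each side of \<open>x t\<close> the tangents seen from there are strictly ordered by height, so each side
  carries at most one tangent through the point of the lower curve; two tangents must use both sides.\<close>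

lemma contact_sides: "X (sR t) < x t" "x t < X (sL t)"
proof -
  have "X (sR t) < X (sL t)"
    using contacts(2) up.x_less_iff by blast
  then show "X (sR t) < x t" "x t < X (sL t)"
    using contact_off[OF sL_contact, of t] contact_off[OF sR_contact, of t]
      contact_unique_right[OF sL_contact sR_contact, of t]
      contact_unique_left[OF sL_contact sR_contact, of t] contacts(2)[of t]
    by (metis less_asym less_irrefl linorder_cases order_less_trans)+
qed

lemma sL_unique: "up.tan_at s (x t) = y t \<Longrightarrow> x t < X s \<Longrightarrow> s = sL t"
  using contact_unique_right sL_contact contact_sides by blast

abbreviation line :: "real \<Rightarrow> real \<Rightarrow> real" where "line t p \<equiv> up.tan_at (sL t) p"

lemma line_alt: "line t p = y t + up.slope_at (sL t) * (p - x t)"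
  using sL_contact[of t] unfolding up.tan_at_def by (simp add: algebra_simps)

text \<open>The left tangent is transversal to the lower curve, because it leads to a point strictly above
  the tangent of the lower curve. This is what makes the contact point move forward.\<close>

lemma slope_at_less: "low.slope_at t < up.slope_at (sL t)"
proof -
  have "low.tan_at t (X (sL t)) < line t (X (sL t))"
    using above_tangent by simp
  then show ?thesis
    unfolding line_alt low.tan_at_def using contact_sides(2)[of t] by auto
qed

lemma line_below_left:
  assumes "r < t" shows "line t (x r) < y r"
proof -
  have "up.slope_at (sL t) * (x r - x t) < low.slope_at t * (x r - x t)"
    using slope_at_less assms low.x_less_iff by (intro mult_strict_right_mono_neg) auto
  then show ?thesis
    using low.tan_at_le[of t r] unfolding line_alt low.tan_at_def by linarith
qed

text \<open>Near its zero \<open>sL t0\<close> the function \<open>s \<mapsto> tan_at s (x t0) - y t0\<close> changes sign; the change of sign persists for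
  nearby \<open>t\<close> and traps \<open>sL t\<close>.\<close>

lemma sL_isCont: "isCont sL t0"
proof (unfold continuous_at_eps_delta, intro allI impI)
  fix e :: real assume "0 < e"
  have "\<forall>\<^sub>F s in nhds (sL t0). x t0 < X s"
    using order_tendstoD(1)[OF DERIV_isCont[OF up.x_deriv, unfolded isCont_def tendsto_at_iff_tendsto_nhds]]
      contact_sides(2)[of t0] by blast
  then obtain d0 where d0: "d0 > 0" "\<And>s. dist s (sL t0) < d0 \<Longrightarrow> x t0 < X s"
    unfolding eventually_nhds_metric by blast
  \<comment> \<open>Both \<open>sL t0 - d\<close> and \<open>sL t0 + d\<close> stay to the right of \<open>x t0\<close>, where the zero is unique.\<close>
  define d where "d = min (d0/2) (e/2)"
  have d: "0 < d" "d < e" "d < d0"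
    using \<open>0 < e\<close> d0(1) by (auto simp: d_def min_def)
  let ?a = "sL t0 - d" and ?b = "sL t0 + d"
  have xa: "x t0 < X ?a" by (rule d0(2)) (use d in \<open>auto simp: dist_real_def\<close>)
  have "y t0 < up.tan_at ?a (x t0)" "up.tan_at ?b (x t0) < y t0"
    using up.tan_at_decreasing[of ?a "sL t0" "x t0"] up.tan_at_decreasing[of "sL t0" ?b "x t0"]
      sL_contact[of t0] contact_sides(2)[of t0] xa d(1) by auto
  moreover have cx: "(x \<longlongrightarrow> x t0) (nhds t0)" and cy: "(y \<longlongrightarrow> y t0) (nhds t0)"
    using DERIV_isCont[OF low.x_deriv] DERIV_isCont[OF low.y_deriv]
    unfolding isCont_def tendsto_at_iff_tendsto_nhds by blast+
  have lim: "((\<lambda>t. up.tan_at s (x t) - y t) \<longlongrightarrow> up.tan_at s (x t0) - y t0) (nhds t0)" for s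
    unfolding up.tan_at_def by (intro tendsto_intros cx cy)
  ultimately have "\<forall>\<^sub>F t in nhds t0. up.tan_at ?a (x t) - y t > 0"
    "\<forall>\<^sub>F t in nhds t0. up.tan_at ?b (x t) - y t < 0" "\<forall>\<^sub>F t in nhds t0. x t < X ?a"
    using order_tendstoD(1)[OF lim[of ?a], of 0] order_tendstoD(2)[OF lim[of ?b], of 0]
      order_tendstoD(2)[OF cx xa] by auto
  then have "\<forall>\<^sub>F t in nhds t0. up.tan_at ?a (x t) - y t > 0 \<and> up.tan_at ?b (x t) - y t < 0 \<and> x t < X ?a"
    by eventually_elim auto
  then obtain r where "r > 0" and r: "\<And>t. dist t t0 < r \<Longrightarrow>
      up.tan_at ?a (x t) - y t > 0 \<and> up.tan_at ?b (x t) - y t < 0 \<and> x t < X ?a"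
    unfolding eventually_nhds_metric by blast
  have "dist (sL t) (sL t0) < e" if near: "dist t t0 < r" for t
  proof -
    obtain s where s: "?a \<le> s" "s \<le> ?b" "up.tan_at s (x t) = y t"
      using IVT2'[of "\<lambda>s. up.tan_at s (x t)" ?b "y t" ?a] r[OF near] d(1) up.tan_at_cont by force
    moreover have "x t < X s"
      using r[OF near] up.x_le_iff s(1) by (meson less_le_trans)
    ultimately show ?thesis
      using sL_unique[of s t] d(2) by (simp add: dist_real_def)
  qed
  with \<open>r > 0\<close> show "\<exists>d>0. \<forall>x'. dist x' t0 < d \<longrightarrow> dist (sL x') (sL t0) < e" by blast
qed

text \<open>The derivative that implicit differentiation of \<open>tan_at (sL t) (x t) = y t\<close> predicts.\<close>

definition sL' :: "real \<Rightarrow> real" where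
  "sL' t = (y' t - up.slope_at (sL t) * x' t) / (up.slope_at' (sL t) * (x t - X (sL t)))"

lemma sL'_pos: "sL' t > 0"
proof -
  have "y' t - up.slope_at (sL t) * x' t < 0"
    using slope_at_less[of t] low.x'_pos[of t] unfolding low.slope_at_def by (simp add: divide_less_eq)
  moreover have "up.slope_at' (sL t) * (x t - X (sL t)) < 0"
    using up.slope_at'_pos contact_sides(2) by (simp add: mult_pos_neg)
  ultimately show ?thesis unfolding sL'_def by (rule divide_neg_neg)
qed

text \<open>Implicit differentiation. Continuity of \<open>sL\<close> is already known, so it is enough to replace the dependence of the
  tangent height on the contact parameter by its Caratheodory slope \<open>q\<close> and to divide.\<close>

lemma sL_deriv: "(sL has_real_derivative sL' t0) (at t0)"
proof -
  let ?s0 = "sL t0"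
  obtain q where q: "\<And>s. up.tan_at s (x t0) - up.tan_at ?s0 (x t0) = q s * (s - ?s0)"
      "isCont q ?s0" "q ?s0 = up.slope_at' ?s0 * (x t0 - X ?s0)"
    using up.tan_at_deriv[of "x t0" ?s0] unfolding CARAT_DERIV by blast
  have q0: "q ?s0 \<noteq> 0"
    using q(3) up.slope_at'_pos[of ?s0] contact_sides(2)[of t0] by auto
  have key: "q (sL t) * (sL t - ?s0) = (y t - y t0) - up.slope_at (sL t) * (x t - x t0)" for t
  proof -
    have "up.tan_at (sL t) (x t0) = y t + up.slope_at (sL t) * (x t0 - x t)" by (rule line_alt)
    then show ?thesis using q(1)[of "sL t"] sL_contact[of t0] by (simp add: algebra_simps)
  qed
  have lim_s: "(sL \<longlongrightarrow> ?s0) (at t0)" using sL_isCont isCont_def by blast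
  have lim_q: "((\<lambda>t. q (sL t)) \<longlongrightarrow> q ?s0) (at t0)"
    using isCont_tendsto_compose[OF q(2) lim_s] .
  have lim_m: "((\<lambda>t. up.slope_at (sL t)) \<longlongrightarrow> up.slope_at ?s0) (at t0)"
    using isCont_tendsto_compose[OF DERIV_isCont[OF up.slope_at_deriv] lim_s] .
  have "((\<lambda>t. ((y t - y t0) / (t - t0) - up.slope_at (sL t) * ((x t - x t0) / (t - t0))) / q (sL t))
      \<longlongrightarrow> (y' t0 - up.slope_at ?s0 * x' t0) / q ?s0) (at t0)"
    using low.x_deriv[of t0] low.y_deriv[of t0] unfolding has_field_derivative_iff
    by (intro tendsto_intros lim_m lim_q q0)
  moreover have "\<forall>\<^sub>F t in at t0. q (sL t) \<noteq> 0"
    using tendsto_imp_eventually_ne[OF lim_q q0] .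
  then have "\<forall>\<^sub>F t in at t0. ((y t - y t0) / (t - t0) - up.slope_at (sL t) * ((x t - x t0) / (t - t0))) / q (sL t)
      = (sL t - ?s0) / (t - t0)"
  proof eventually_elim
    case (elim t)
    have "(y t - y t0) / (t - t0) - up.slope_at (sL t) * ((x t - x t0) / (t - t0))
      = (q (sL t) * (sL t - ?s0)) / (t - t0)"
      unfolding key by (simp only: diff_divide_distrib[of "y t - y t0"] times_divide_eq_right)
    then show ?case using elim by simp
  qed
  ultimately show ?thesis
    unfolding has_field_derivative_iff sL'_def q(3)[symmetric] by (rule Lim_transform_eventually)
qed

lemma sL_cont: "continuous_on A sL"
  by (rule continuous_on_if_DERIV, rule sL_deriv)

lemma sL_strict_mono: "s < t \<Longrightarrow> sL s < sL t"
  by (rule DERIV_pos_imp_increasing) (use sL_deriv sL'_pos in blast)+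

text \<open>The function \<open>\<lambda>\<close> of \<open>w' = \<lambda> (g - w)\<close>, read off from the first coordinate of this equation.\<close>

definition lam :: "real \<Rightarrow> real" where
  "lam t = sL' t * X' (sL t) / (x t - X (sL t))"

lemma lam_neg: "lam t < 0"
  unfolding lam_def using sL'_pos up.x'_pos contact_sides(2) by (simp add: divide_pos_neg)

lemma continuous_on_comp_sL: "continuous_on UNIV h \<Longrightarrow> continuous_on A (\<lambda>t. h (sL t))"
  using continuous_on_compose2[OF _ sL_cont] by blast

lemma lam_cont: "continuous_on A lam"
proof -
  have "up.slope_at' (sL t) * (x t - X (sL t)) \<noteq> 0" "x t - X (sL t) \<noteq> 0" for t
    using up.slope_at'_pos[of "sL t"] contact_sides(2)[of t] by auto
  then show ?thesis
    unfolding lam_def[abs_def] sL'_def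
    by (intro continuous_intros continuous_on_comp_sL low.cont up.cont up.slope_at'_cont) auto
qed

lemma contact_x_deriv: "((\<lambda>t. X (sL t)) has_real_derivative lam t * (x t - X (sL t))) (at t)"
proof -
  have "lam t * (x t - X (sL t)) = X' (sL t) * sL' t"
    using contact_sides(2)[of t] unfolding lam_def by simp
  then show ?thesis using DERIV_chain2[OF up.x_deriv sL_deriv] by simp
qed

lemma contact_y_deriv: "((\<lambda>t. Y (sL t)) has_real_derivative lam t * (y t - Y (sL t))) (at t)"
proof -
  have "y t - Y (sL t) = up.slope_at (sL t) * (x t - X (sL t))"
    using sL_contact[of t] unfolding up.tan_at_def by simp
  then have "lam t * (y t - Y (sL t)) = up.slope_at (sL t) * (sL' t * X' (sL t))"
    using contact_sides(2)[of t] unfolding lam_def by simp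
  also have "\<dots> = Y' (sL t) * sL' t"
    using up.x'_pos[of "sL t"] unfolding up.slope_at_def by simp
  finally show ?thesis using DERIV_chain2[OF up.y_deriv sL_deriv] by simp
qed

lemma line_cont: "continuous_on A (\<lambda>t. line t p)"
  by (rule continuous_on_comp_sL) (rule up.tan_at_cont)

end

section \<open>The domain is swept by the left tangent segments\<close>

lemma closed_segment_graph:
  fixes a b m :: real and h :: "real \<Rightarrow> real"
  assumes "a \<le> b" and "\<And>p. h p = h a + m * (p - a)"
  shows "closed_segment (a, h a) (b, h b) = {(p, h p) | p. a \<le> p \<and> p \<le> b}"
proof -
  have "(1 - u) * h a + u * h b = h ((1 - u) * a + u * b)" for u
    by (subst assms(2)[of b], subst assms(2)[of "(1 - u) * a + u * b"]) (simp add: algebra_simps)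
  then have "closed_segment (a, h a) (b, h b) = (\<lambda>p. (p, h p)) ` closed_segment a b"
    unfolding closed_segment_def by (auto simp: image_iff) 
  then show ?thesis using assms(1) by (auto simp: closed_segment_eq_real_ivl)
qed

context tangent_domain
begin

definition left_segment :: "real \<Rightarrow> (real \<times> real) set" where
  "left_segment t = {(p, line t p) | p. x t \<le> p \<and> p \<le> X (sL t)}"

lemma left_segment_eq: "closed_segment (x t, y t) (X (sL t), Y (sL t)) = left_segment t"
  using closed_segment_graph[of "x t" "X (sL t)" "line t" "up.slope_at (sL t)"] contact_sides(2)[of t]
    sL_contact[of t] line_alt[of t] unfolding left_segment_def by simp

lemma right_segment_eq: "closed_segment (x t, y t) (X (sR t), Y (sR t))
    = {(p, up.tan_at (sR t) p) | p. X (sR t) \<le> p \<and> p \<le> x t}"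
proof -
  have "up.tan_at (sR t) p = Y (sR t) + up.slope_at (sR t) * (p - X (sR t))" for p
    by (simp add: up.tan_at_def)
  then show ?thesis
    using closed_segment_graph[of "X (sR t)" "x t" "up.tan_at (sR t)" "up.slope_at (sR t)"] 
      contact_sides(1)[of t] sR_contact[of t] by (simp add: closed_segment_commute)
qed

text \<open>The union of the curvilinear triangles in coordinates.\<close>

definition domain :: "(real \<times> real) set" where
  "domain = (\<Union>t. {(p, q). \<exists>lo hi. (p, lo) \<in> closed_segment (x t, y t) (X (sL t), Y (sL t))
        \<union> closed_segment (x t, y t) (X (sR t), Y (sR t)) \<and>
      (p, hi) \<in> (\<lambda>s. (X s, Y s)) ` {sR t..sL t} \<and> lo \<le> q \<and> q \<le> hi})"

lemma left_segment_subset_domain: "left_segment t \<subseteq> domain"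
proof
  fix z assume "z \<in> left_segment t"
  then obtain p where p: "z = (p, line t p)" "x t \<le> p" "p \<le> X (sL t)"
    unfolding left_segment_def by blast
  have "X (sR t) \<le> p" using p(2) contact_sides(1)[of t] by linarith
  then obtain s where "sR t \<le> s" "s \<le> sL t" "X s = p" using up.x_IVT p(3) by blast
  moreover have "line t p \<le> Y s" using up.tan_at_le[of "sL t" s] \<open>X s = p\<close> by simp
  ultimately show "z \<in> domain"
    using p \<open>z \<in> left_segment t\<close> unfolding domain_def left_segment_eq by fastforce
qed

text \<open>The second intersection lies to the left of the contact point: the slope \<open>m\<close> of the right tangent is
  compared with the slopes of the lower curve at both intersections, using that the contact
  point is above the tangents of the lower curve there.\<close>

lemma second_intersection_left:
  "\<exists>t'. x t' < X (sR t) \<and> up.tan_at (sR t) (x t') = y t'"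
proof -
  define m where "m = up.slope_at (sR t)"
  obtain t' where t': "t' \<noteq> t" "up.tan_at (sR t) (x t') = y t'"
    using second_intersection[OF sR_contact] by blast
  have line: "up.tan_at (sR t) p = y t + m * (p - x t)" "up.tan_at (sR t) p = y t' + m * (p - x t')" for p
    using sR_contact[of t] t'(2) unfolding up.tan_at_def m_def by (simp_all add: algebra_simps)
  have "low.slope_at t * (X (sR t) - x t) < m * (X (sR t) - x t)"
    using above_tangent[of t "sR t"] line(1)[of "X (sR t)"] by (simp add: low.tan_at_def)
  then have "m < low.slope_at t"
    using contact_sides(1)[of t] by (auto simp: mult_less_cancel_right)
  moreover have "low.slope_at t * (x t' - x t) < m * (x t' - x t)"
    using low.tan_at_less[OF t'(1)] line(1)[of "x t'"] t'(2) by (simp add: low.tan_at_def)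
  ultimately have "x t' < x t" by (auto simp: mult_less_cancel_right)
  have "low.slope_at t' * (x t - x t') < m * (x t - x t')"
    using low.tan_at_less[of t t'] t'(1) line(2)[of "x t"] sR_contact[of t] by (simp add: low.tan_at_def)
  then have "low.slope_at t' < m" using \<open>x t' < x t\<close> by (auto simp: mult_less_cancel_right)
  moreover have "low.slope_at t' * (X (sR t) - x t') < m * (X (sR t) - x t')"
    using above_tangent[of t' "sR t"] line(2)[of "X (sR t)"] by (simp add: low.tan_at_def)
  ultimately have "x t' < X (sR t)" by (auto simp: mult_less_cancel_right)
  with t'(2) show ?thesis by blast
qed

text \<open>The tangent at \<open>s\<close> passes above the lower curve at the contact point and, being at least as steep as the right
  tangent at \<open>sR t\<close>, not above it at the second intersection of that tangent; so it crosses the lower curve in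
  between, and from the crossing point it is seen as the left tangent.\<close>

lemma contact_is_sL:
  assumes "sR t \<le> s" obtains r where "s = sL r"
proof -
  obtain t' where t': "x t' < X (sR t)" "up.tan_at (sR t) (x t') = y t'"
    using second_intersection_left by blast
  have le: "x t' < X s" using t'(1) assms up.x_le_iff[of "sR t" s] by linarith
  have 1: "up.tan_at s (x t') \<le> y t'"
    using up.tan_at_decreasing[of "sR t" s "x t'"] assms t' by (cases "s = sR t") auto
  obtain v where v: "x v = X s" "y v < Y s" using above by blast
  have "continuous_on {t'..v} (\<lambda>r. up.tan_at s (x r) - y r)"
    unfolding up.tan_at_def by (intro continuous_intros low.cont)
  then obtain r where r: "r \<le> v" "up.tan_at s (x r) - y r = 0"
    using IVT'[of "\<lambda>r. up.tan_at s (x r) - y r" t' 0 v] 1 v le low.x_less_iff[of t' v]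
      up.tan_at_self[of s] by auto
  then have "x r \<le> X s" using v low.x_le_iff by metis
  moreover have "x r \<noteq> X s" using contact_off[of s r] r(2) by auto
  ultimately show ?thesis using that sL_unique[of s r] r(2) by auto
qed

text \<open>A chord from the lower curve to the upper one stays in the epigraph of the lower curve.\<close>

lemma contact_chord_above:
  assumes "up.tan_at s (x t) = y t" "x t \<le> x w \<and> x w \<le> X s \<or> X s \<le> x w \<and> x w \<le> x t"
  shows "y w \<le> up.tan_at s (x w)"
proof (rule ccontr)
  assume neg: "\<not> y w \<le> up.tan_at s (x w)"
  define k where "k = up.slope_at s - low.slope_at w"
  have "low.tan_at w (x t) \<le> y t" "low.tan_at w (X s) < up.tan_at s (X s)"
    using low.tan_at_le above_tangent[of w s] by simp_all
  then have "0 < k * (x t - x w)" "0 < k * (X s - x w)"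
    using neg assms(1) unfolding k_def up.tan_at_def low.tan_at_def
    by (simp_all add: algebra_simps)
  then show False using assms(2) by (auto simp: zero_less_mult_iff)
qed

text \<open>Turning a tangent of the upper curve from the contact parameter of the point above \<open>(p, q)\<close> to \<open>sL t\<close> lowers its height
  at \<open>p\<close> from at least \<open>q\<close> to at most \<open>q\<close>. The tangent that passes through \<open>(p, q)\<close> is a left tangent by
  \<open>contact_is_sL\<close>, and it can be followed to the left down to the lower curve.\<close>

lemma domain_cases:
  assumes "(p, q) \<in> domain" "(p, q) \<notin> range (\<lambda>t. (x t, y t))"
  obtains t where "x t < p" "p \<le> X (sL t)" "q = line t p"
proof -
  obtain t lo hi where t: "(p, lo) \<in> closed_segment (x t, y t) (X (sL t), Y (sL t))
        \<union> closed_segment (x t, y t) (X (sR t), Y (sR t))"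
      "(p, hi) \<in> (\<lambda>s. (X s, Y s)) ` {sR t..sL t}" "lo \<le> q" "q \<le> hi"
    using assms(1) unfolding domain_def by blast
  then obtain s where s: "sR t \<le> s" "s \<le> sL t" "X s = p" "Y s = hi" by auto
  have lo: "lo = line t p \<and> x t \<le> p \<or> lo = up.tan_at (sR t) p \<and> p \<le> x t"
    using t(1) unfolding left_segment_eq right_segment_eq left_segment_def by auto
  have slope_at_le: "up.slope_at (sR t) < up.slope_at (sL t)" using contacts(2) up.slope_at_less_iff by blast
  have R: "up.tan_at (sR t) p = y t + up.slope_at (sR t) * (p - x t)"
    using sR_contact[of t] unfolding up.tan_at_def by (simp add: algebra_simps)
  have "line t p \<le> lo"
    using lo
  proof
    assume *: "lo = up.tan_at (sR t) p \<and> p \<le> x t"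
    then have "up.slope_at (sL t) * (p - x t) \<le> up.slope_at (sR t) * (p - x t)"
      using slope_at_le by (intro mult_right_mono_neg) auto
    then show ?thesis using * R line_alt[of t p] by linarith
  qed auto
  moreover have "up.tan_at s p = hi" using s by (metis up.tan_at_self)
  ultimately obtain r where r: "s \<le> r" "r \<le> sL t" "up.tan_at r p = q"
    using IVT2'[of "\<lambda>s. up.tan_at s p" "sL t" q s] t(3,4) s(2) up.tan_at_cont by force
  then obtain v where v: "r = sL v" using contact_is_sL[of t r] s(1) by force
  \<comment> \<open>The lower curve at abscissa \<open>p\<close> is not above the point, so the point is not to the left of the start of the segment.\<close>
  obtain w where w: "x w = p" using above[of s] s(3) by metis
  have "y w \<le> lo"
    using t(1) contact_chord_above[OF sL_contact, of t w] contact_chord_above[OF sR_contact, of t w] w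
    unfolding left_segment_eq right_segment_eq left_segment_def by auto
  then have "\<not> w < v" using line_below_left[of w v] w v r(3) t(3) by auto
  then have "x v \<le> p" using w low.x_le_iff[of v w] by auto
  moreover have "x v \<noteq> p" using assms(2) r(3) v sL_contact[of v] by auto
  moreover have "p \<le> X (sL v)" using s(3) r(1) v up.x_le_iff by metis
  ultimately show ?thesis using that[of v] r(3) v by auto
qed

end

section \<open>A change of variables with exponential speed\<close>

text \<open>The weight \<open>E t = exp (\<integral>\<^sub>u\<^sup>t \<lambda>)\<close> decreases from \<open>1\<close> to \<open>0\<close>. The clock is the inverse of \<open>t \<mapsto> a + L * E t\<close>, so it runs
  from infinity at \<open>a\<close> down to \<open>u\<close> at \<open>a + L\<close>; from there on it stands still.\<close>

locale exponential_clock =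
  fixes lam :: "real \<Rightarrow> real" and u a L :: real
  assumes lam_cont: "continuous_on UNIV lam" and lam_neg: "lam t < 0" and L_pos: "0 < L"
    and decay: "((\<lambda>t. exp (integral {u..t} lam)) \<longlongrightarrow> 0) at_top"
begin

definition E :: "real \<Rightarrow> real" where "E t = exp (integral {u..t} lam)"

lemma E_start [simp]: "E u = 1"
  by (simp add: E_def)

lemma E_pos: "E t > 0"
  by (simp add: E_def)

lemma E_deriv_within:
  assumes "u \<le> t" "t \<le> v" shows "(E has_real_derivative lam t * E t) (at t within {u..v})"
proof -
  have "((\<lambda>t. integral {u..t} lam) has_real_derivative lam t) (at t within {u..v})"
    using assms continuous_on_subset[OF lam_cont]
    by (intro integral_has_real_derivative) auto
  from DERIV_chain'[OF this DERIV_exp] show ?thesis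
    unfolding E_def[abs_def] by (simp add: mult.commute)
qed

lemma E_deriv: "u < t \<Longrightarrow> (E has_real_derivative lam t * E t) (at t)"
  using E_deriv_within[of t "t + 1"] at_within_Icc_at[of u t "t + 1"] by simp

lemma E_cont_Icc: "continuous_on {u..v} E"
  by (rule DERIV_continuous_on, rule E_deriv_within) auto

lemma E_decreasing:
  assumes "u \<le> s" "s < t" shows "E t < E s"
proof (rule DERIV_neg_imp_decreasing_open[OF assms(2)])
  fix r assume "s < r" "r < t"
  then show "\<exists>y. (E has_real_derivative y) (at r) \<and> y < 0"
    using E_deriv[of r] lam_neg[of r] E_pos[of r] assms(1) mult_neg_pos by fastforce
next
  show "continuous_on {s..t} E"
    using assms(1) by (intro continuous_on_subset[OF E_cont_Icc[of t]]) auto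
qed

lemma E_eq_iff: "u \<le> s \<Longrightarrow> u \<le> t \<Longrightarrow> E t = E s \<longleftrightarrow> s = t"
  using E_decreasing[of s t] E_decreasing[of t s] by (cases s t rule: linorder_cases) auto

lemma E_surj:
  assumes "0 < r" "r \<le> 1" obtains t where "u \<le> t" "E t = r"
proof -
  have "\<forall>\<^sub>F t in at_top. E t < r"
    using decay assms(1) unfolding E_def by (rule order_tendstoD(2))
  then obtain v where v: "u \<le> v" "E v < r"
    using eventually_happens'[OF _ eventually_conj[OF _ eventually_ge_at_top[of u]]] by force
  then obtain t where "u \<le> t" "t \<le> v" "E t = r"
    using IVT2'[of E v r u] assms E_cont_Icc by auto
  then show ?thesis using that by blast
qed

text \<open>The minimum with \<open>1\<close> keeps the clock at \<open>u\<close> after \<open>a + L\<close>; the value at \<open>a\<close>, where the clock would be infinite, is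
  set to \<open>u\<close> so that a function composed with the clock is defined on the closed interval.\<close>

definition clock :: "real \<Rightarrow> real" where
  "clock s = (if s \<le> a then u else THE t. u \<le> t \<and> E t = min 1 ((s - a) / L))"

lemma clock_spec: assumes "a < s" shows "u \<le> clock s" "E (clock s) = min 1 ((s - a) / L)"
proof -
  have "0 < min 1 ((s - a) / L)" using assms L_pos by simp
  then obtain t where t: "u \<le> t" "E t = min 1 ((s - a) / L)" using E_surj[of "min 1 ((s - a) / L)"] by auto
  have "(THE t. u \<le> t \<and> E t = min 1 ((s - a) / L)) = t"
  proof (rule the_equality)
    fix v assume "u \<le> v \<and> E v = min 1 ((s - a) / L)"
    then show "v = t" using E_eq_iff[of v t] t by simp
  qed (use t in simp)
  then have "clock s = t" using assms unfolding clock_def by simp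
  then show "u \<le> clock s" "E (clock s) = min 1 ((s - a) / L)" using t by auto
qed

lemma clock_ge: "u \<le> clock s"
  using clock_spec(1)[of s] by (cases "a < s") (auto simp: clock_def)

lemma clock_eqI: "a < s \<Longrightarrow> u \<le> t \<Longrightarrow> E t = min 1 ((s - a) / L) \<Longrightarrow> clock s = t"
  using clock_spec[of s] E_eq_iff by metis

lemma clock_late: "a + L \<le> s \<Longrightarrow> clock s = u"
  using L_pos by (intro clock_eqI) (auto simp: min_def field_simps)

lemma clock_start: "clock a = u" by (simp add: clock_def)

lemma clock_antimono:
  assumes "a < s" "s \<le> r" shows "clock r \<le> clock s"
proof (rule ccontr)
  assume "\<not> clock r \<le> clock s"
  then have "E (clock r) < E (clock s)" using E_decreasing clock_ge by simp
  moreover have "(s - a) / L \<le> (r - a) / L" using assms(2) L_pos by (simp add: divide_right_mono)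
  ultimately show False using clock_spec(2)[of s] clock_spec(2)[of r] assms by (auto simp: min_def split: if_splits)
qed

lemma clock_early:
  assumes "a < s" "u \<le> v" "s \<le> a + L * E v" shows "v \<le> clock s"
proof (rule ccontr)
  assume "\<not> v \<le> clock s"
  then have "E v < E (clock s)" using E_decreasing clock_ge by simp
  moreover have "(s - a) / L \<le> E v" using assms(3) L_pos by (simp add: field_simps)
  ultimately show False using clock_spec(2)[OF assms(1)] by auto
qed

lemma E_clock: "a < s \<Longrightarrow> s \<le> a + L \<Longrightarrow> L * E (clock s) = s - a"
  using clock_spec(2)[of s] L_pos by (simp add: min_def field_simps)

lemma clock_at_top: "filterlim clock at_top (at_right a)"
  unfolding filterlim_at_top_gt[where c = u]
proof (intro allI impI)
  fix v assume "u < v"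
  have "\<forall>\<^sub>F s in at_right a. a < s \<and> s < a + L * E v"
    unfolding eventually_at_right_field using L_pos E_pos by (intro exI[of _ "a + L * E v"]) auto
  then show "\<forall>\<^sub>F s in at_right a. v \<le> clock s"
    by eventually_elim (use clock_early \<open>u < v\<close> in auto)
qed

text \<open>On a compact parameter interval \<open>E\<close> is a homeomorphism onto its image. The interval is taken long enough for the image to
  contain all values of \<open>min 1 ((q - a) / L)\<close> for \<open>q\<close> near \<open>s\<close>, including those after the clock has stopped.\<close>

lemma clock_isCont:
  assumes "a < s" shows "isCont clock s"
proof -
  have "0 < (s - a) / L" using assms L_pos by simp
  then obtain r where r: "0 < r" "r < 1" "r < (s - a) / L"
    using field_lbound_gt_zero[of 1 "(s - a) / L"] by auto
  then obtain v where v: "u \<le> v" "E v = r" using E_surj[of r] by auto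
  define F where "F = the_inv_into {u..v} E"
  have inj: "inj_on E {u..v}" using E_eq_iff by (auto simp: inj_on_def)
  have F: "t \<in> {u..v} \<Longrightarrow> F (E t) = t" for t unfolding F_def using inj by (rule the_inv_into_f_f)
  have img: "{r..1} \<subseteq> E ` {u..v}"
  proof
    fix q assume "q \<in> {r..1}"
    then show "q \<in> E ` {u..v}" using IVT2'[of E v q u] v E_cont_Icc[of v] by auto
  qed
  have Fcont: "continuous_on {r..1} F"
    using continuous_on_inv[OF E_cont_Icc compact_Icc, of v F] F continuous_on_subset[OF _ img] by auto
  define S where "S = {a + L * r<..}"
  have "continuous_on S (\<lambda>q. F (min 1 ((q - a) / L)))"
    using r L_pos unfolding S_def
    by (intro continuous_on_compose2[OF Fcont] continuous_intros) (auto simp: field_simps)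
  moreover have "F (min 1 ((q - a) / L)) = clock q" if "q \<in> S" for q
  proof -
    have "0 < L * r" using r L_pos by simp
    then have aq: "a < q" using that unfolding S_def by simp
    have "min 1 ((q - a) / L) \<in> {r..1}"
      using that r L_pos unfolding S_def by (auto simp: field_simps)
    then obtain t where t: "t \<in> {u..v}" "E t = min 1 ((q - a) / L)" using img by (metis imageE subsetD)
    then have "clock q = t" using aq by (intro clock_eqI) auto
    then show ?thesis using F[OF t(1)] t(2) by simp
  qed
  ultimately have "continuous_on S clock" using continuous_on_cong[of S S] by (metis (no_types, lifting))
  moreover have "s \<in> S" "open S" using r L_pos unfolding S_def by (auto simp: field_simps)
  ultimately show ?thesis using continuous_on_eq_continuous_at by blast
qed

lemma clock_cont: "A \<subseteq> {a<..} \<Longrightarrow> continuous_on A clock"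
  using clock_isCont continuous_at_imp_continuous_on by blast

lemma clock_deriv:
  assumes "a < s" "s < a + L"
  shows "(clock has_real_derivative inverse (lam (clock s) * (s - a))) (at s)"
proof -
  have "L * E (clock s) < L * 1" using E_clock[of s] assms by simp
  then have "E (clock s) < 1" using L_pos by simp
  then have "u < clock s" using clock_ge[of s] by (cases "clock s = u") auto
  from DERIV_cmult[OF E_deriv[OF this], of L]
  have "((\<lambda>t. L * E t) has_real_derivative lam (clock s) * (s - a)) (at (clock s))"
    using E_clock[of s] assms by (simp add: mult.left_commute[of L])
  then have "((\<lambda>t. a + L * E t) has_real_derivative lam (clock s) * (s - a)) (at (clock s))"
    using DERIV_add[OF DERIV_const] by fastforce
  then show ?thesis
    by (rule DERIV_inverse_function[of _ _ _ _ a "a + L"])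
       (use assms lam_neg[of "clock s"] E_clock clock_isCont in auto)
qed

text \<open>The change of variables \<open>s = a + L * E t\<close>: an antiderivative of \<open>A \<circ> clock\<close> is \<open>(s - a) * B (clock s)\<close>
  as soon as \<open>B\<close> is attracted by \<open>A\<close> at the rate of the clock.\<close>

definition primitive :: "(real \<Rightarrow> real) \<Rightarrow> (real \<Rightarrow> real) \<Rightarrow> real \<Rightarrow> real" where
  "primitive A B s = (min s (a + L) - a) * B (clock s) + max 0 (s - (a + L)) * A u"

lemma primitive_start [simp]: "primitive A B a = 0"
  using L_pos by (simp add: primitive_def)

lemma primitive_early: "s \<le> a + L \<Longrightarrow> primitive A B s = (s - a) * B (clock s)"
  by (simp add: primitive_def)

lemma primitive_late: "a + L \<le> s \<Longrightarrow> primitive A B s = L * B u + (s - (a + L)) * A u"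
  by (simp add: primitive_def clock_late)

lemma primitive_deriv:
  assumes "\<And>t. u < t \<Longrightarrow> (B has_real_derivative lam t * (A t - B t)) (at t)"
    and "a < s" "s \<noteq> a + L"
  shows "(primitive A B has_real_derivative A (clock s)) (at s)"
proof (cases "s < a + L")
  case True
  have "L * E (clock s) < L * 1" using E_clock[of s] assms(2) True by simp
  then have "E (clock s) < 1" using L_pos by simp
  then have "u < clock s" using clock_ge[of s] by (cases "clock s = u") auto
  from DERIV_chain2[OF assms(1)[OF this] clock_deriv[OF assms(2) True]]
  have "((\<lambda>s. (s - a) * B (clock s)) has_real_derivative
      1 * B (clock s) + lam (clock s) * (A (clock s) - B (clock s)) * inverse (lam (clock s) * (s - a)) * (s - a)) (at s)"
    by (intro DERIV_mult) (auto intro!: derivative_eq_intros)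
  moreover have "1 * B (clock s) + lam (clock s) * (A (clock s) - B (clock s)) * inverse (lam (clock s) * (s - a)) * (s - a) = A (clock s)"
    using assms(2) lam_neg[of "clock s"] by (simp add: field_simps)
  ultimately have "((\<lambda>s. (s - a) * B (clock s)) has_real_derivative A (clock s)) (at s)" by simp
  then show ?thesis
    by (rule has_field_derivative_transform_within_open[of _ _ _ "{..<a + L}"])
       (use True primitive_early in auto)
next
  case False
  then have s: "a + L < s" using assms(3) by simp
  have "((\<lambda>s. L * B u + (s - (a + L)) * A u) has_real_derivative A u) (at s)"
    by (auto intro!: derivative_eq_intros)
  then have "(primitive A B has_real_derivative A u) (at s)"
    by (rule has_field_derivative_transform_within_open[of _ _ _ "{a + L<..}"])
       (use s primitive_late in auto)
  then show ?thesis using clock_late s by simp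
qed

lemma comp_clock_cont:
  assumes "continuous_on {u..} B" "S \<subseteq> {a<..}" shows "continuous_on S (\<lambda>s. B (clock s))"
  by (rule continuous_on_compose2[OF assms(1) clock_cont[OF assms(2)]]) (use clock_ge in auto)

lemma primitive_cont:
  assumes "continuous_on {u..} B" "S \<subseteq> {a<..}"
  shows "continuous_on S (primitive A B)"
  unfolding primitive_def[abs_def] by (intro continuous_intros comp_clock_cont assms)

lemma has_integral_comp_clock:
  assumes "continuous_on {u..} B" "\<And>t. u < t \<Longrightarrow> (B has_real_derivative lam t * (A t - B t)) (at t)"
    and "a < c" "c \<le> d"
  shows "((\<lambda>s. A (clock s)) has_integral primitive A B d - primitive A B c) {c..d}"
proof (rule fundamental_theorem_of_calculus_interior_strong[where S = "{a + L}"])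
  fix s assume "s \<in> {c<..<d} - {a + L}"
  then show "(primitive A B has_vector_derivative A (clock s)) (at s)"
    using primitive_deriv[OF assms(2), of s] assms(3)
    by (auto simp: has_real_derivative_iff_has_vector_derivative)
next
  show "continuous_on {c..d} (primitive A B)"
    using assms(3) by (intro primitive_cont[OF assms(1)]) auto
qed (use assms(4) in auto)

text \<open>The interval may start at \<open>a\<close>, where the clock is infinite, because \<open>(s - a) * B (clock s) = L * E t * B t\<close>
  with \<open>t = clock s\<close> vanishes there.\<close>

lemma has_integral_comp_clock_start:
  assumes "continuous_on {u..} B" "\<And>t. u < t \<Longrightarrow> (B has_real_derivative lam t * (A t - B t)) (at t)"
    and "((\<lambda>t. E t * B t) \<longlongrightarrow> 0) at_top" and "a \<le> d"
  shows "((\<lambda>s. A (clock s)) has_integral primitive A B d) {a..d}"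
proof (cases "a = d")
  case False
  then have "a < d" using assms by simp
  have "((\<lambda>s. A (clock s)) has_integral primitive A B d - primitive A B a) {a..d}"
  proof (rule fundamental_theorem_of_calculus_interior_strong[where S = "{a + L}"])
    fix s assume "s \<in> {a<..<d} - {a + L}"
    then show "(primitive A B has_vector_derivative A (clock s)) (at s)"
      using primitive_deriv[OF assms(2), of s] 
      by (auto simp: has_real_derivative_iff_has_vector_derivative)
  next
    have "((\<lambda>s. L * (E (clock s) * B (clock s))) \<longlongrightarrow> L * 0) (at_right a)"
      by (intro tendsto_intros filterlim_compose[OF assms(3) clock_at_top])
    moreover have "\<forall>\<^sub>F s in at_right a. L * (E (clock s) * B (clock s)) = primitive A B s"
      unfolding eventually_at_right_field
    proof (intro exI[of _ "a + L"] conjI allI impI)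
      fix s assume "a < s" "s < a + L"
      then show "L * (E (clock s) * B (clock s)) = primitive A B s"
        using primitive_early[of s A B] E_clock[of s] by (simp add: mult.assoc[symmetric])
    qed (use L_pos in auto)
    ultimately have "(primitive A B \<longlongrightarrow> 0) (at_right a)"
      using Lim_transform_eventually by fastforce
    then have "continuous (at a within {a..d}) (primitive A B)"
      using at_within_Icc_at_right[OF \<open>a < d\<close>] by (simp add: continuous_within)
    moreover have "continuous (at s within {a..d}) (primitive A B)" if "a < s" for s
      using primitive_cont[OF assms(1) order_refl] that continuous_at_imp_continuous_at_within
      unfolding continuous_on_eq_continuous_at[OF open_greaterThan] by blast
    ultimately show "continuous_on {a..d} (primitive A B)"
      unfolding continuous_on_eq_continuous_within by (auto simp: le_less)
  qed (use \<open>a < d\<close> in auto)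
  then show ?thesis by simp
next
  case True
  show ?thesis unfolding True[symmetric] by (simp add: has_integral_refl)
qed

text \<open>In the time \<open>ln (1 / E)\<close> the speed of \<open>B\<close> is \<open>B - A = o (1 / E)\<close>, so \<open>B\<close> itself is \<open>o (1 / E)\<close>. The proof applies
  l'Hopital's rule to \<open>B / (1 / E)\<close>.\<close>

lemma attracted_decay:
  assumes "\<And>t. u < t \<Longrightarrow> (B has_real_derivative lam t * (A t - B t)) (at t)"
    and "((\<lambda>t. E t * (A t - B t)) \<longlongrightarrow> 0) at_top"
  shows "((\<lambda>t. E t * B t) \<longlongrightarrow> 0) at_top"
proof -
  have gt: "\<forall>\<^sub>F t in at_top. u < t" by (rule eventually_gt_at_top)
  have "((\<lambda>t. B t / inverse (E t)) \<longlongrightarrow> 0) at_top"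
  proof (rule lhospital_at_top_at_top)
    show "LIM t at_top. inverse (E t) :> at_top"
      using decay E_pos unfolding E_def[symmetric]
      by (intro filterlim_inverse_at_top) (auto intro: always_eventually)
    show "\<forall>\<^sub>F t in at_top. - (lam t / E t) \<noteq> 0"
      using lam_neg E_pos by (intro always_eventually) (auto simp: less_imp_neq[symmetric] less_imp_neq)
    show "\<forall>\<^sub>F t in at_top. (B has_real_derivative lam t * (A t - B t)) (at t)"
      using gt by eventually_elim (rule assms(1))
    show "\<forall>\<^sub>F t in at_top. ((\<lambda>t. inverse (E t)) has_real_derivative - (lam t / E t)) (at t)"
      using gt
    proof eventually_elim
      case (elim t)
      show ?case
        using DERIV_inverse'[OF E_deriv[OF elim]] E_pos[of t] by (simp add: field_simps)
    qed
    have "((\<lambda>t. - (E t * (A t - B t))) \<longlongrightarrow> - 0) at_top" by (rule tendsto_minus[OF assms(2)])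
    moreover have "- (E t * (A t - B t)) = lam t * (A t - B t) / - (lam t / E t)" for t
      using lam_neg[of t] E_pos[of t] by (simp add: field_simps)
    ultimately show "((\<lambda>t. lam t * (A t - B t) / - (lam t / E t)) \<longlongrightarrow> 0) at_top" by simp
  qed
  then show ?thesis by (simp add: divide_inverse mult.commute)
qed

end

section \<open>Infinite value along the clock\<close>

context exponential_clock
begin

text \<open>With \<open>H T = \<integral>\<^sub>u\<^sup>T f' E\<close> the function \<open>B = f - H / E\<close> is attracted by \<open>f\<close>, which gives the integral of \<open>f \<circ> clock\<close> away
  from \<open>a\<close>. Freezing the clock at time \<open>T\<close> bounds the whole integral from below by a constant plus \<open>L * H T\<close>,
  because \<open>f\<close> increases after \<open>v\<close>; the boundary terms \<open>E T * f T\<close> cancel.\<close>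

lemma ext_integral_comp_clock_infinite:
  assumes f_deriv: "\<And>t. (f has_real_derivative f' t) (at t)" and f'_cont: "continuous_on UNIV f'"
    and incr: "\<And>t. v \<le> t \<Longrightarrow> 0 \<le> f' t"
    and div: "filterlim (\<lambda>T. integral {u..T} (\<lambda>t. f' t * E t)) at_top at_top"
    and b: "a + L \<le> b"
  shows "ext_integral_exists {a..b} (\<lambda>s. f (clock s))" "ext_integral {a..b} (\<lambda>s. f (clock s)) = \<infinity>"
proof -
  define H where "H T = integral {u..T} (\<lambda>t. f' t * E t)" for T
  have Hderiv_within: "(H has_real_derivative f' t * E t) (at t within {u..w})" if "u \<le> t" "t \<le> w" for t w
    unfolding H_def[abs_def] using that
    by (intro integral_has_real_derivative continuous_intros E_cont_Icc continuous_on_subset[OF f'_cont]) auto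
  then have Hderiv: "(H has_real_derivative f' t * E t) (at t)" if "u < t" for t
    using that Hderiv_within[of t "t + 1"] at_within_Icc_at[of u t "t + 1"] by simp
  have Hcont: "continuous_on {u..} H"
    by (rule continuous_on_atLeast_if_Icc, rule DERIV_continuous_on, rule Hderiv_within) auto
  have fcont: "continuous_on S f" for S
    using f_deriv by (rule continuous_on_if_DERIV)
  define B where "B t = f t - H t / E t" for t
  have Bcont: "continuous_on {u..} B"
    unfolding B_def[abs_def] using E_pos
    by (intro continuous_intros fcont Hcont continuous_on_atLeast_if_Icc E_cont_Icc) (auto simp: less_imp_neq[symmetric])
  have Bderiv: "(B has_real_derivative lam t * (f t - B t)) (at t)" if "u < t" for t
  proof -
    have "(B has_real_derivative f' t - (f' t * E t * E t - H t * (lam t * E t)) / (E t * E t)) (at t)"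
      unfolding B_def[abs_def] using E_pos[of t]
      by (intro DERIV_diff f_deriv DERIV_divide Hderiv E_deriv that) auto
    moreover have "f' t - (f' t * E t * E t - H t * (lam t * E t)) / (E t * E t) = lam t * (f t - B t)"
      unfolding B_def using E_pos[of t] by (simp add: field_simps)
    ultimately show ?thesis by simp
  qed
  have mono: "f s \<le> f t" if "v \<le> s" "s \<le> t" for s t
  proof (rule DERIV_nonneg_imp_nondecreasing[OF that(2)])
    fix r assume "s \<le> r"
    then show "\<exists>D. (f has_real_derivative D) (at r) \<and> 0 \<le> D"
      using f_deriv[of r] incr[of r] that(1) by (intro exI[of _ "f' r"]) auto
  qed
  have "compact (f ` {u..max u v})"
    by (intro compact_continuous_image fcont compact_Icc)
  then obtain C where "\<forall>z\<in>f ` {u..max u v}. norm z \<le> C"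
    using compact_imp_bounded bounded_iff by blast
  then have C: "\<bar>f t\<bar> \<le> C" if "t \<in> {u..max u v}" for t using that by auto
  \<comment> \<open>On \<open>[u, max u v]\<close> the function is bounded by continuity, afterwards it increases.\<close>
  have lower: "- C \<le> f t" if "u \<le> t" for t
  proof -
    have "f (min t (max u v)) \<le> f t"
    proof (cases "max u v \<le> t")
      case True
      then show ?thesis using mono[OF max.cobounded2 True] by (simp only: min_absorb2)
    next
      case False
      then have "min t (max u v) = t" by linarith
      then show ?thesis by simp
    qed
    moreover have "\<bar>f (min t (max u v))\<bar> \<le> C" by (rule C) (use that in auto)
    ultimately show ?thesis by linarith
  qed
  have "(\<integral>\<^sup>+ s\<in>{a..b}. ennreal (- f (clock s)) \<partial>lebesgue) \<le> (\<integral>\<^sup>+ s. ennreal C * indicator {a..b} s \<partial>lebesgue)"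
    using lower[OF clock_ge] by (intro nn_integral_mono mult_right_mono ennreal_leI) (auto simp: minus_le_iff)
  also have "\<dots> = ennreal C * ennreal (b - a)"
    using b L_pos by (subst nn_integral_cmult_indicator) auto
  also have "\<dots> < \<infinity>" by (simp add: ennreal_mult_less_top)
  finally have neg: "(\<integral>\<^sup>+ s\<in>{a..b}. ennreal (- f (clock s)) \<partial>lebesgue) < \<infinity>" .
  then show "ext_integral_exists {a..b} (\<lambda>s. f (clock s))"
    by (simp add: ext_integral_exists_def)
  let ?I = "\<integral>\<^sup>+ s\<in>{a..b}. ennreal (f (clock s)) \<partial>lebesgue"
  define c0 where "c0 = L * B u + (b - (a + L)) * f u"
  have bound: "ennreal (c0 + L * H T) \<le> ?I" if T: "u \<le> T" "v \<le> T" for T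
  proof -
    define s0 where "s0 = a + L * E T"
    have "E T \<le> E u" using E_decreasing[of u T] T by (cases "u = T") auto
    then have "E T \<le> 1" by simp
    then have s0: "a < s0" "s0 \<le> a + L" using L_pos E_pos[of T] unfolding s0_def by auto
    have clock_s0: "clock s0 = T"
      using s0 T L_pos \<open>E T \<le> 1\<close> by (intro clock_eqI) (auto simp: s0_def)
    have "((\<lambda>s. f (clock (max s s0))) has_integral (s0 - a) * f T) {a..s0}"
      using has_integral_const_real[of "f T" a s0] s0
      by (rule_tac has_integral_eq[of _ "\<lambda>s. f T"]) (auto simp: clock_s0 max_def)
    moreover have "((\<lambda>s. f (clock (max s s0))) has_integral primitive f B b - primitive f B s0) {s0..b}"
      using has_integral_comp_clock[OF Bcont Bderiv s0(1), of b] s0 b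
      by (rule_tac has_integral_eq[of _ "\<lambda>s. f (clock s)"]) (auto simp: max_def)
    ultimately have "((\<lambda>s. f (clock (max s s0))) has_integral
        (s0 - a) * f T + (primitive f B b - primitive f B s0)) {a..b}"
      using s0 b by (intro has_integral_combine[of a s0 b]) auto
    moreover have "(s0 - a) * f T + (primitive f B b - primitive f B s0) = c0 + L * H T"
    proof -
      have "L * E T * B T = L * E T * f T - L * H T"
        using E_pos[of T] unfolding B_def by (simp add: field_simps)
      then show ?thesis
        using primitive_early[OF s0(2), of f B] primitive_late[OF b, of f B]
        unfolding c0_def clock_s0 by (simp add: s0_def)
    qed
    ultimately have int: "((\<lambda>s. f (clock (max s s0))) has_integral c0 + L * H T) {a..b}" by simp
    have "continuous_on {a..b} (\<lambda>s. max 0 (f (clock (max s s0))))"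
      using s0 by (intro continuous_intros continuous_on_compose2[OF fcont[of UNIV]]
        continuous_on_compose2[OF clock_cont[of "{a<..}"]]) auto
    then obtain J where J: "((\<lambda>s. max 0 (f (clock (max s s0)))) has_integral J) {a..b}"
      using integrable_continuous_real by blast
    \<comment> \<open>The value at \<open>a\<close> is corrected because the clock is \<open>u\<close> there, so that the comparison with \<open>f (clock s)\<close> holds at every point.\<close>
    define k where "k s = (if s = a then max 0 (f u) else max 0 (f (clock (max s s0))))" for s
    have kJ: "(k has_integral J) {a..b}"
      using J by (rule has_integral_spike_finite[of "{a}", rotated 2]) (auto simp: k_def)
    \<comment> \<open>Only the positive part of the frozen function can be compared with a nonnegative integral.\<close>
    have "c0 + L * H T \<le> J"
      by (rule has_integral_le[OF int J]) auto
    then have "ennreal (c0 + L * H T) \<le> ennreal J" by (rule ennreal_leI)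
    also have "ennreal J = (\<integral>\<^sup>+ s\<in>{a..b}. ennreal (k s) \<partial>lebesgue)"
      using nn_integral_has_integral_lebesgue'[OF _ kJ] by (simp add: nn_integral_completion k_def)
    also have "\<dots> \<le> ?I"
    proof (intro nn_integral_mono)
      fix s
      have "k s \<le> max 0 (f (clock s))" if "a \<le> s"
      proof (cases "s = a \<or> s0 \<le> s")
        case True
        then show ?thesis by (auto simp: k_def clock_start max_def)
      next
        case False
        then have "f T \<le> f (clock s)" using that s0 T
          by (intro mono clock_early) (auto simp: s0_def)
        then show ?thesis using False by (auto simp: k_def clock_s0 max_def)
      qed
      then have "ennreal (k s) \<le> ennreal (max 0 (f (clock s)))" if "a \<le> s" using that by (simp add: ennreal_leI)
      then show "ennreal (k s) * indicator {a..b} s \<le> ennreal (f (clock s)) * indicator {a..b} s"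
        by (auto simp: indicator_def ennreal_max_0)
    qed
    finally show ?thesis .
  qed
  have "?I = \<infinity>"
  proof (rule ccontr)
    assume "?I \<noteq> \<infinity>"
    then obtain R where R: "?I = ennreal R" "0 \<le> R" by (cases ?I) auto
    have "\<forall>\<^sub>F T in at_top. (R - c0 + 1) / L \<le> H T \<and> u \<le> T \<and> v \<le> T"
      using div unfolding H_def[symmetric, abs_def] filterlim_at_top
      by (intro eventually_conj eventually_ge_at_top) auto
    then obtain T where T: "(R - c0 + 1) / L \<le> H T" "u \<le> T" "v \<le> T"
      using eventually_happens' by force
    then have "R + 1 \<le> c0 + L * H T" using L_pos by (simp add: field_simps)
    moreover have "c0 + L * H T \<le> R" using bound[OF T(2,3)] R by simp
    ultimately show False by simp
  qed
  then show "ext_integral {a..b} (\<lambda>s. f (clock s)) = \<infinity>"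
    unfolding ext_integral_def using neg by simp
qed

end

section \<open>Test functions with averages in the domain\<close>

context tangent_domain
begin

text \<open>The left tangent with the later parameter is below the earlier left segment: it is so at both
  ends of the segment, on the lower curve and at the contact point.\<close>

lemma line_antimono:
  assumes "v \<le> t" "x v \<le> p" "p \<le> X (sL v)" shows "line t p \<le> line v p"
proof -
  define k where "k = up.slope_at (sL v) - up.slope_at (sL t)"
  have D: "line v q - line t q = (line v r - line t r) + k * (q - r)" for q r
    unfolding up.tan_at_def k_def by (simp add: algebra_simps)
  have ends: "0 \<le> line v (x v) - line t (x v)" "0 \<le> line v (X (sL v)) - line t (X (sL v))"
    using line_below_left[of v t] assms(1) sL_contact[of v] up.tan_at_le[of "sL t" "sL v"] up.tan_at_self[of "sL v"]
    by (cases "v = t"; simp)+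
  show ?thesis
  proof (cases "0 \<le> k")
    case True
    then have "0 \<le> k * (p - x v)" using assms(2) by simp
    then show ?thesis using D[of p "x v"] ends(1) by linarith
  next
    case False
    then have "0 \<le> k * (p - X (sL v))" using assms(3) by (simp add: mult_nonpos_nonpos)
    then show ?thesis using D[of p "X (sL v)"] ends(2) by linarith
  qed
qed

text \<open>Here \<open>(q, line v q)\<close> is an average over an initial interval that ends at the time \<open>v\<close>, the contact point of \<open>w\<close> is the
  average over a shorter initial interval, and \<open>(p1, p2)\<close> is the average over the rest. Beyond the chord of the
  first two, the point is not above the left tangent of \<open>v\<close> and not below that of \<open>w\<close>, so a left tangent in between
  passes through it. Since the point is above the lower curve, it lies on the segment part of that tangent.\<close>

lemma beyond_chord_in_domain:
  assumes "v \<le> w" and "x v \<le> q" "q \<le> X (sL v)" and "0 \<le> k"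
    and p: "p1 = q + k * (q - X (sL w))" "p2 = line v q + k * (line v q - Y (sL w))"
    and r: "x r = p1" "y r \<le> p2"
  shows "(p1, p2) \<in> domain"
proof -
  have beyond: "p2 - line t p1 = (line v q - line t q) + k * ((line v q - line t q) - (Y (sL w) - line t (X (sL w))))" for t
    unfolding p up.tan_at_def[of "sL t"] by (simp add: algebra_simps)
  have Yw: "line t (X (sL w)) \<le> Y (sL w)" for t
    by (rule up.tan_at_le)
  have "p2 - line v p1 \<le> 0"
    using beyond[of v] mult_left_mono[OF Yw[of v] \<open>0 \<le> k\<close>] by (simp add: algebra_simps)
  moreover have "0 \<le> p2 - line w p1"
    using beyond[of w] line_antimono[OF assms(1-3)] \<open>0 \<le> k\<close> up.tan_at_self[of "sL w"] by simp
  ultimately obtain t where t: "v \<le> t" "t \<le> w" "line t p1 = p2"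
    using IVT2'[of "\<lambda>t. line t p1" w p2 v] assms(1) line_cont by auto
  have mono: "X (sL v) \<le> X (sL t)" if "v \<le> t" for t
    using that sL_strict_mono[of v t] up.x_le_iff by (cases "v = t") auto
  have "q - X (sL w) \<le> 0" using assms(3) mono[OF assms(1)] by linarith
  then have "p1 \<le> q" using \<open>0 \<le> k\<close> p(1) by (simp add: mult_nonneg_nonpos)
  then have "p1 \<le> X (sL t)" using assms(3) mono[OF t(1)] by linarith
  moreover have "x t \<le> p1"
    using line_below_left[of r t] r t(3) low.x_le_iff[of t r] by (cases "r < t") auto
  ultimately show ?thesis
    using left_segment_subset_domain[of t] t(3) unfolding left_segment_def by blast
qed

text \<open>The first assumption of the theorem, with the base point of the integral as a parameter: it does not
  matter which one is used.\<close>

definition vanishing :: "real \<Rightarrow> bool" where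
  "vanishing u \<longleftrightarrow> ((\<lambda>t. (1 + norm ((X (sL t), Y (sL t)) - (x t, y t))) * exp (integral {u..t} lam)) \<longlongrightarrow> 0) at_top"

lemma integral_lam_shift:
  assumes "max u v \<le> t"
  shows "integral {u..t} lam = (integral {u..max u v} lam - integral {v..max u v} lam) + integral {v..t} lam"
proof -
  have "integral {r..max u v} lam + integral {max u v..t} lam = integral {r..t} lam" if "r \<le> max u v" for r
    using assms that by (intro Henstock_Kurzweil_Integration.integral_combine integrable_continuous_real lam_cont) auto
  from this[of u] this[of v] show ?thesis by simp
qed

lemma vanishing_shift:
  assumes "vanishing v" shows "vanishing u"
proof -
  define c where "c = exp (integral {u..max u v} lam - integral {v..max u v} lam)"
  let ?n = "\<lambda>t. 1 + norm ((X (sL t), Y (sL t)) - (x t, y t))"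
  have "((\<lambda>t. c * (?n t * exp (integral {v..t} lam))) \<longlongrightarrow> c * 0) at_top"
    using assms unfolding vanishing_def by (intro tendsto_intros)
  moreover have "\<forall>\<^sub>F t in at_top. c * (?n t * exp (integral {v..t} lam)) = ?n t * exp (integral {u..t} lam)"
    using eventually_ge_at_top[of "max u v"]
  proof eventually_elim
    case (elim t)
    have "exp (integral {u..t} lam) = c * exp (integral {v..t} lam)"
      unfolding integral_lam_shift[OF elim] c_def exp_add by (rule refl)
    then show ?case by simp
  qed
  ultimately show ?thesis
    unfolding vanishing_def using Lim_transform_eventually by fastforce
qed

end

text \<open>The clock driven by the left tangents that start at \<open>u\<close>.\<close>

locale left_tangent_flow = tangent_domain +
  fixes u a L :: real
  assumes flow_decay: "vanishing u" and flow_pos: "0 < L"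
begin

lemma vanishing_bound:
  assumes "\<And>t. \<bar>h t\<bar> \<le> 1 + norm ((X (sL t), Y (sL t)) - (x t, y t))"
  shows "((\<lambda>t. exp (integral {u..t} lam) * h t) \<longlongrightarrow> 0) at_top"
proof (rule Lim_null_comparison)
  show "((\<lambda>t. (1 + norm ((X (sL t), Y (sL t)) - (x t, y t))) * exp (integral {u..t} lam)) \<longlongrightarrow> 0) at_top"
    using flow_decay unfolding vanishing_def .
  show "\<forall>\<^sub>F t in at_top. norm (exp (integral {u..t} lam) * h t)
      \<le> (1 + norm ((X (sL t), Y (sL t)) - (x t, y t))) * exp (integral {u..t} lam)"
    using assms by (intro always_eventually allI) (simp add: abs_mult mult.commute[of "exp _"] del: norm_Pair)
qed

sublocale exponential_clock lam u a L
proof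
  show "((\<lambda>t. exp (integral {u..t} lam)) \<longlongrightarrow> 0) at_top"
    using vanishing_bound[of "\<lambda>t. 1"] by simp
qed (use lam_cont lam_neg flow_pos in auto)

abbreviation "Px \<equiv> primitive x (\<lambda>t. X (sL t))"
abbreviation "Py \<equiv> primitive y (\<lambda>t. Y (sL t))"

lemma contact_decay:
  "((\<lambda>t. E t * X (sL t)) \<longlongrightarrow> 0) at_top" "((\<lambda>t. E t * Y (sL t)) \<longlongrightarrow> 0) at_top"
proof -
  have bounds: "\<bar>x t - X (sL t)\<bar> \<le> 1 + norm ((X (sL t), Y (sL t)) - (x t, y t))"
      "\<bar>y t - Y (sL t)\<bar> \<le> 1 + norm ((X (sL t), Y (sL t)) - (x t, y t))" for t
    using norm_fst_le[of "X (sL t) - x t" "Y (sL t) - y t"] norm_snd_le[of "Y (sL t) - y t" "X (sL t) - x t"]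
    unfolding diff_Pair real_norm_def by linarith+
  have "((\<lambda>t. E t * (x t - X (sL t))) \<longlongrightarrow> 0) at_top" "((\<lambda>t. E t * (y t - Y (sL t))) \<longlongrightarrow> 0) at_top"
    unfolding E_def by (rule vanishing_bound[OF bounds(1)], rule vanishing_bound[OF bounds(2)])
  then show "((\<lambda>t. E t * X (sL t)) \<longlongrightarrow> 0) at_top" "((\<lambda>t. E t * Y (sL t)) \<longlongrightarrow> 0) at_top"
    using attracted_decay[OF contact_x_deriv] attracted_decay[OF contact_y_deriv] by blast+
qed

lemma coordinate_integrals:
  assumes "a \<le> c" "c \<le> d"
  shows "((\<lambda>s. x (clock s)) has_integral Px d - Px c) {c..d}"
    and "((\<lambda>s. y (clock s)) has_integral Py d - Py c) {c..d}"
proof -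
  have X: "continuous_on {u..} (\<lambda>t. X (sL t))" and Y: "continuous_on {u..} (\<lambda>t. Y (sL t))"
    by (intro continuous_on_comp_sL up.cont)+
  show "((\<lambda>s. x (clock s)) has_integral Px d - Px c) {c..d}"
  proof (cases "c = a")
    case True
    then show ?thesis
      using has_integral_comp_clock_start[OF X contact_x_deriv contact_decay(1), of d] assms by simp
  next
    case False
    then show ?thesis
      using has_integral_comp_clock[OF X contact_x_deriv, of c d] assms by simp
  qed
  show "((\<lambda>s. y (clock s)) has_integral Py d - Py c) {c..d}"
  proof (cases "c = a")
    case True
    then show ?thesis
      using has_integral_comp_clock_start[OF Y contact_y_deriv contact_decay(2), of d] assms by simp
  next
    case False
    then show ?thesis
      using has_integral_comp_clock[OF Y contact_y_deriv, of c d] assms by simp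
  qed
qed

text \<open>Up to \<open>a + L\<close> the average over \<open>[a, d]\<close> is the contact point at time \<open>clock d\<close>; afterwards it
  moves along the left segment of \<open>u\<close> towards the lower curve.\<close>

lemma initial_average:
  assumes "a < d"
  shows "x (clock d) \<le> Px d / (d - a)" "Px d / (d - a) \<le> X (sL (clock d))"
    "Py d / (d - a) = line (clock d) (Px d / (d - a))"
proof -
  let ?t = "clock d"
  obtain \<theta> where \<theta>: "0 \<le> \<theta>" "\<theta> \<le> 1"
    "Px d / (d - a) = x ?t + \<theta> * (X (sL ?t) - x ?t)" "Py d / (d - a) = y ?t + \<theta> * (Y (sL ?t) - y ?t)"
  proof (cases "d \<le> a + L")
    case True
    then show ?thesis using that[of 1] assms by (simp add: primitive_early)
  next
    case False
    then have *: "clock d = u" "Px d = L * X (sL u) + (d - (a + L)) * x u" "Py d = L * Y (sL u) + (d - (a + L)) * y u"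
      by (simp_all add: clock_late primitive_late)
    \<comment> \<open>The clock has run for the fraction \<open>L / (d - a)\<close> of the interval.\<close>
    show ?thesis
      by (rule that[of "L / (d - a)"]) (use False assms L_pos in \<open>simp_all add: * field_simps\<close>)
  qed
  have "0 \<le> \<theta> * (X (sL ?t) - x ?t)" "\<theta> * (X (sL ?t) - x ?t) \<le> X (sL ?t) - x ?t"
    using \<theta>(1,2) contact_sides(2)[of ?t] by (auto intro: mult_left_le_one_le)
  then show "x ?t \<le> Px d / (d - a)" "Px d / (d - a) \<le> X (sL ?t)"
    unfolding \<theta>(3) by linarith+
  have "Y (sL ?t) - y ?t = up.slope_at (sL ?t) * (X (sL ?t) - x ?t)"
    using line_alt[of ?t "X (sL ?t)"] by simp
  then show "Py d / (d - a) = line ?t (Px d / (d - a))"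
    unfolding \<theta>(3,4) line_alt by simp
qed

lemma clock_mono_Icc:
  assumes "a < c" "s \<in> {c..d}" shows "clock d \<le> clock s" "clock s \<le> clock c"
  using assms clock_antimono[of s d] clock_antimono[of c s] by auto

text \<open>For \<open>a < c < a + L\<close> the average over \<open>[c, d]\<close> lies beyond a chord of the curve of initial averages, and above the lower curve
  by Jensen's inequality; the latter is applied in the form of a tangent of the lower curve at the point \<open>r\<close>
  below the average.\<close>

lemma average_in_domain:
  assumes "a \<le> c" "c < d"
  shows "((Px d - Px c) / (d - c), (Py d - Py c) / (d - c)) \<in> domain"
proof -
  consider "c = a" | "a < c" "c < a + L" | "a + L \<le> c" using assms(1) by linarith
  then show ?thesis
  proof cases
    case 1
    then show ?thesis
      using initial_average[of d] assms(2) left_segment_subset_domain[of "clock d"]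
      unfolding left_segment_def by auto
  next
    case 2
    let ?p = "(Px d - Px c) / (d - c)" and ?q = "(Py d - Py c) / (d - c)"
    have int: "((\<lambda>s. x (clock s)) has_integral Px d - Px c) {c..d}"
      "((\<lambda>s. y (clock s)) has_integral Py d - Py c) {c..d}"
      using coordinate_integrals assms by auto
    have const: "((\<lambda>s. r) has_integral r * (d - c)) {c..d}" for r :: real
      using has_integral_const_real[of r c d] assms by (simp add: mult.commute)
    have "x (clock d) * (d - c) \<le> Px d - Px c" "Px d - Px c \<le> x (clock c) * (d - c)"
      using clock_mono_Icc[OF 2(1)] low.x_le_iff
      by (auto intro!: has_integral_le[OF const int(1)] has_integral_le[OF int(1) const])
    then have "x (clock d) \<le> ?p" "?p \<le> x (clock c)"
      using assms by (simp_all add: field_simps)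
    then obtain r where r: "x r = ?p" by (rule low.x_IVT)
    \<comment> \<open>Jensen's inequality: the lower curve is above its tangent at \<open>r\<close>, and the average of this tangent along the clock is \<open>y r\<close>.\<close>
    define n where "n = low.slope_at r"
    have "((\<lambda>s. y r + n * (x (clock s) - x r)) has_integral y r * (d - c) + n * ((Px d - Px c) - x r * (d - c))) {c..d}"
      by (intro has_integral_add has_integral_mult_right has_integral_diff const int)
    moreover have "n * ((Px d - Px c) - x r * (d - c)) = 0"
      unfolding r using assms by simp
    ultimately have "((\<lambda>s. y r + n * (x (clock s) - x r)) has_integral y r * (d - c)) {c..d}" by simp
    from has_integral_le[OF this int(2)] have "y r * (d - c) \<le> Py d - Py c"
      using low.tan_at_le[of r] unfolding low.tan_at_def n_def by auto
    then have yr: "y r \<le> ?q" using assms by (simp add: field_simps)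
    \<comment> \<open>The average over \<open>[c, d]\<close> is the average over \<open>[a, d]\<close> plus \<open>k\<close> times its difference from the average over \<open>[a, c]\<close>.\<close>
    define q k where "q = Px d / (d - a)" and "k = (c - a) / (d - c)"
    have d: "x (clock d) \<le> q" "q \<le> X (sL (clock d))" "line (clock d) q = Py d / (d - a)"
      using initial_average[of d] 2 assms unfolding q_def by auto
    have Pc: "Px c = (c - a) * X (sL (clock c))" "Py c = (c - a) * Y (sL (clock c))"
      using primitive_early 2 by auto
    have "(z - (c - a) * w) / (d - c) = z / (d - a) + k * (z / (d - a) - w)" for z w
    proof -
      have "1 + k = (d - a) / (d - c)" using assms unfolding k_def by (simp add: field_simps)
      then have "(1 + k) * (z / (d - a)) = z / (d - c)" using 2 assms by simp
      moreover have "z / (d - a) + k * (z / (d - a) - w) = (1 + k) * (z / (d - a)) - k * w"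
        by (simp only: algebra_simps)
      moreover have "(c - a) * w / (d - c) = k * w" unfolding k_def by simp
      ultimately show ?thesis by (simp only: diff_divide_distrib)
    qed
    then have "?p = q + k * (q - X (sL (clock c)))"
      "?q = line (clock d) q + k * (line (clock d) q - Y (sL (clock c)))"
      unfolding Pc d(3) by (simp_all add: q_def)
    moreover have "clock d \<le> clock c" using clock_antimono 2 assms by simp
    moreover have "0 \<le> k" using 2 assms unfolding k_def by simp
    ultimately show ?thesis
      using beyond_chord_in_domain[OF _ d(1,2)] r yr by blast
  next
    case 3
    have "((Px d - Px c) / (d - c), (Py d - Py c) / (d - c)) = (x u, y u)"
      using 3 assms by (simp add: primitive_late left_diff_distrib[symmetric])
    moreover have "(x u, y u) \<in> left_segment u"
      using contact_sides(2)[of u] sL_contact[of u] unfolding left_segment_def by auto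
    ultimately show ?thesis using left_segment_subset_domain by auto
  qed
qed

definition test_fun :: "real \<Rightarrow> real \<times> real" where
  "test_fun s = (x (clock s), y (clock s))"

lemma test_fun_integral:
  assumes "a \<le> c" "c \<le> d" shows "(test_fun has_integral (Px d - Px c, Py d - Py c)) {c..d}"
proof (rule has_integral_componentwise)
  fix b :: "real \<times> real" assume "b \<in> Basis"
  then have "b = (1, 0) \<or> b = (0, 1)" by (auto simp: Basis_prod_def)
  then show "((\<lambda>s. test_fun s \<bullet> b) has_integral (Px d - Px c, Py d - Py c) \<bullet> b) {c..d}"
    using coordinate_integrals[OF assms] unfolding test_fun_def by (elim disjE) simp_all
qed

text \<open>Integrability is known in the sense of Henstock and Kurzweil. It is absolute since \<open>x\<close> is bounded
  below along the clock, and \<open>y\<close> is bounded below by an affine function of \<open>x\<close>.\<close>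

lemma test_fun_absolutely_integrable:
  assumes "a \<le> d" shows "test_fun absolutely_integrable_on {a..d}"
proof -
  have 1: "(\<lambda>s. x (clock s)) integrable_on {a..d}" "(\<lambda>s. y (clock s)) integrable_on {a..d}"
    using coordinate_integrals[OF order_refl assms] by blast+
  have "(\<lambda>s. x (clock s) - x u) absolutely_integrable_on {a..d}"
    using low.x_le_iff clock_ge
    by (intro nonnegative_absolutely_integrable_1 integrable_diff 1 integrable_const_ivl) auto
  from set_integral_add(1)[OF this absolutely_integrable_on_const[of "{a..d}" "x u"]]
  have X: "(\<lambda>s. x (clock s)) absolutely_integrable_on {a..d}" by simp
  have line: "(\<lambda>s. low.tan_at u (x (clock s))) absolutely_integrable_on {a..d}"
    unfolding low.tan_at_def
    by (intro set_integral_add set_integral_diff set_integrable_mult_right X absolutely_integrable_on_const) auto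
  have "(\<lambda>s. y (clock s) - low.tan_at u (x (clock s))) absolutely_integrable_on {a..d}"
    using low.tan_at_le set_lebesgue_integral_eq_integral(1)[OF line]
    by (intro nonnegative_absolutely_integrable_1 integrable_diff 1) auto
  from set_integral_add(1)[OF this line]
  have Y: "(\<lambda>s. y (clock s)) absolutely_integrable_on {a..d}" by simp
  show ?thesis
  proof (rule absolutely_integrable_componentwise)
    fix b :: "real \<times> real" assume "b \<in> Basis"
    then have "b = (1, 0) \<or> b = (0, 1)" by (auto simp: Basis_prod_def)
    then show "(\<lambda>s. test_fun s \<bullet> b) absolutely_integrable_on {a..d}"
      using X Y unfolding test_fun_def by (elim disjE) simp_all
  qed
qed

lemma test_fun_average:
  assumes "a \<le> c" "c < d"
  shows "average c d test_fun = ((Px d - Px c) / (d - c), (Py d - Py c) / (d - c))"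
proof -
  have "test_fun absolutely_integrable_on {c..d}"
    using test_fun_absolutely_integrable[of d] assms
    by (intro set_integrable_subset[of lebesgue "{a..d}" test_fun "{c..d}"]) auto
  then have "(LINT s:{c..d}|lebesgue. test_fun s) = (Px d - Px c, Py d - Py c)"
    using test_fun_integral[of c d] assms set_lebesgue_integral_eq_integral(2) integral_unique
    by (metis less_imp_le)
  then show ?thesis by (simp add: average_def)
qed

end

section \<open>The sign of the derivative and the divergence of the tail\<close>

lemma eventually_sign_if_monotone:
  fixes k :: "real \<Rightarrow> real"
  assumes "(\<forall>s t. p \<le> s \<longrightarrow> s \<le> t \<longrightarrow> k s \<le> k t) \<or> (\<forall>s t. p \<le> s \<longrightarrow> s \<le> t \<longrightarrow> k t \<le> k s)"
  shows "\<exists>T. (\<forall>t\<ge>T. 0 \<le> k t) \<or> (\<forall>t\<ge>T. k t \<le> 0)"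
  using assms
proof
  assume mono: "\<forall>s t. p \<le> s \<longrightarrow> s \<le> t \<longrightarrow> k s \<le> k t"
  show ?thesis
  proof (cases "\<exists>s\<ge>p. 0 \<le> k s")
    case True
    then obtain s where "p \<le> s" "0 \<le> k s" by blast
    then show ?thesis using mono order_trans by blast
  next
    case False
    then show ?thesis by (meson linear)
  qed
next
  assume mono: "\<forall>s t. p \<le> s \<longrightarrow> s \<le> t \<longrightarrow> k t \<le> k s"
  show ?thesis
  proof (cases "\<exists>s\<ge>p. k s \<le> 0")
    case True
    then obtain s where "p \<le> s" "k s \<le> 0" by blast
    then show ?thesis using mono order_trans by blast
  next
    case False
    then show ?thesis by (meson linear)
  qed
qed

text \<open>One of the finitely many intervals is unbounded above, hence contains a half-line.\<close>

lemma eventually_sign_if_piecewise_monotone: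
  assumes "piecewise_monotone K" shows "\<exists>T. (\<forall>t\<ge>T. 0 \<le> K t) \<or> (\<forall>t\<ge>T. K t \<le> 0)"
proof -
  obtain P where P: "finite P" "\<Union>P = (UNIV :: real set)"
    "\<And>I. I \<in> P \<Longrightarrow> is_interval I \<and> (mono_on I K \<or> monotone_on I (\<le>) (\<ge>) K)"
    using assms unfolding piecewise_monotone_def by blast
  have "\<exists>I\<in>P. \<not> bdd_above I"
  proof (rule ccontr)
    assume "\<not> (\<exists>I\<in>P. \<not> bdd_above I)"
    then have "\<forall>I\<in>P. bdd_above I" by simp
    then have "bdd_above (\<Union>I\<in>P. I)" by (rule bdd_above_UN[OF P(1), THEN iffD2])
    then obtain B where "\<forall>t::real. t \<le> B" using P(2) unfolding bdd_above_def by auto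
    then show False using gt_ex[of B] by (simp add: not_le[symmetric])
  qed
  then obtain I where I: "I \<in> P" "\<not> bdd_above I" by auto
  then obtain p where "p \<in> I" by (metis bdd_above_empty equals0I)
  have "t \<in> I" if "p \<le> t" for t
  proof -
    obtain z where "z \<in> I" "t < z" using I(2) unfolding bdd_above_def by (meson not_le)
    then show ?thesis using P(3)[OF I(1)] \<open>p \<in> I\<close> that unfolding is_interval_1 by (meson less_imp_le)
  qed
  then show ?thesis
    using P(3)[OF I(1)] by (intro eventually_sign_if_monotone[of p]) (auto simp: monotone_on_def)
qed

lemma eventually_sign_if_deriv_sign:
  fixes k :: "real \<Rightarrow> real"
  assumes "\<And>t. (k has_real_derivative k' t) (at t)" "(\<forall>t\<ge>T. 0 \<le> k' t) \<or> (\<forall>t\<ge>T. k' t \<le> 0)"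
  shows "\<exists>T. (\<forall>t\<ge>T. 0 \<le> k t) \<or> (\<forall>t\<ge>T. k t \<le> 0)"
proof (rule eventually_sign_if_monotone[of T])
  show "(\<forall>s t. T \<le> s \<longrightarrow> s \<le> t \<longrightarrow> k s \<le> k t) \<or> (\<forall>s t. T \<le> s \<longrightarrow> s \<le> t \<longrightarrow> k t \<le> k s)"
    using assms(2)
  proof
    assume *: "\<forall>t\<ge>T. 0 \<le> k' t"
    have "k s \<le> k t" if "T \<le> s" "s \<le> t" for s t
      by (rule DERIV_nonneg_imp_nondecreasing[OF that(2)]) (meson assms(1) * that(1) order_trans)
    then show ?thesis by blast
  next
    assume *: "\<forall>t\<ge>T. k' t \<le> 0"
    have "k t \<le> k s" if "T \<le> s" "s \<le> t" for s t
      by (rule DERIV_nonpos_imp_nonincreasing[OF that(2)]) (meson assms(1) * that(1) order_trans)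
    then show ?thesis by blast
  qed
qed

text \<open>The sign of \<open>\<kappa>\<^sub>3' / \<kappa>\<^sub>2'\<close> is eventually constant, hence so is that of \<open>\<kappa>\<^sub>3'\<close>; so \<open>\<kappa>\<^sub>3 = f' / x'\<close> is eventually monotone, and its
  sign, which is that of \<open>f'\<close>, is eventually constant too.\<close>

lemma (in convex_curve) regular_eventually_sign:
  assumes f'_deriv: "\<And>t. (f' has_real_derivative f'' t) (at t)"
    and pm: "piecewise_monotone (\<lambda>t. deriv (\<lambda>t. f' t / x' t) t / slope_at' t)"
  shows "\<exists>T. (\<forall>t\<ge>T. 0 \<le> f' t) \<or> (\<forall>t\<ge>T. f' t \<le> 0)"
proof -
  define D where "D t = (f'' t * x' t - f' t * x'' t) / (x' t * x' t)" for t
  have D: "((\<lambda>t. f' t / x' t) has_real_derivative D t) (at t)" for t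
    unfolding D_def by (intro DERIV_divide f'_deriv x'_deriv) (use x'_pos[of t] in auto)
  then have "deriv (\<lambda>t. f' t / x' t) = D" by (auto intro: DERIV_imp_deriv)
  then have "\<exists>T. (\<forall>t\<ge>T. 0 \<le> D t) \<or> (\<forall>t\<ge>T. D t \<le> 0)"
    using eventually_sign_if_piecewise_monotone[OF pm] slope_at'_pos
    by (simp add: zero_le_divide_iff divide_le_0_iff less_imp_le not_le[symmetric])
  then have "\<exists>T. (\<forall>t\<ge>T. 0 \<le> f' t / x' t) \<or> (\<forall>t\<ge>T. f' t / x' t \<le> 0)"
    using eventually_sign_if_deriv_sign[OF D] by blast
  then show ?thesis
    using x'_pos by (simp add: zero_le_divide_iff divide_le_0_iff less_imp_le not_le[symmetric])
qed

lemma nn_integral_atLeast_finite: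
  fixes h :: "real \<Rightarrow> real"
  assumes cont: "continuous_on {v..} h" and bound: "\<And>T. v \<le> T \<Longrightarrow> integral {v..T} (\<lambda>t. max 0 (h t)) \<le> R"
  shows "(\<integral>\<^sup>+ t\<in>{v..}. ennreal (h t) \<partial>lebesgue) < \<infinity>"
proof -
  \<comment> \<open>Exhausting the half-line by the intervals \<open>[v, v + n]\<close>, by monotone convergence.\<close>
  define k where "k n t = ennreal (max 0 (h t)) * indicator {v..v + real n} t" for n :: nat and t
  have cmax: "continuous_on {v..v + real n} (\<lambda>t. max 0 (h t))" for n
    by (intro continuous_intros continuous_on_subset[OF cont]) auto
  have eq: "ennreal (h t) * indicator {v..} t = (SUP n. k n t)" for t
  proof (rule antisym)
    obtain n :: nat where n: "t - v \<le> real n" using real_arch_simple by blast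
    have "ennreal (h t) * indicator {v..} t \<le> k n t"
      using n by (auto simp: k_def indicator_def ennreal_max_0)
    then show "ennreal (h t) * indicator {v..} t \<le> (SUP n. k n t)" by (rule SUP_upper2[OF UNIV_I])
    show "(SUP n. k n t) \<le> ennreal (h t) * indicator {v..} t"
      by (rule SUP_least) (auto simp: k_def indicator_def ennreal_max_0)
  qed
  have "incseq k"
    unfolding k_def incseq_def le_fun_def by (auto simp: indicator_def)
  moreover have "k n \<in> borel_measurable lborel" for n
  proof -
    have "(\<lambda>t. indicator {v..v + real n} t *\<^sub>R max 0 (h t)) \<in> borel_measurable borel"
      by (intro borel_measurable_continuous_on_indicator cmax) auto
    moreover have "k n = (\<lambda>t. ennreal (indicator {v..v + real n} t *\<^sub>R max 0 (h t)))"
      by (auto simp: k_def indicator_def)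
    ultimately show ?thesis by simp
  qed
  ultimately have "(\<integral>\<^sup>+ t. (SUP n. k n t) \<partial>lborel) = (SUP n. \<integral>\<^sup>+ t. k n t \<partial>lborel)"
    by (rule nn_integral_monotone_convergence_SUP)
  also have "\<dots> \<le> ennreal R"
  proof (rule SUP_least)
    fix n
    have "(\<integral>\<^sup>+ t. k n t \<partial>lborel) = ennreal (integral {v..v + real n} (\<lambda>t. max 0 (h t)))"
      unfolding k_def
      by (intro nn_integral_has_integral_lebesgue' integrable_integral integrable_continuous_real cmax) auto
    also have "\<dots> \<le> ennreal R" by (intro ennreal_leI bound) auto
    finally show "(\<integral>\<^sup>+ t. k n t \<partial>lborel) \<le> ennreal R" .
  qed
  also have "\<dots> < \<infinity>" by simp
  finally show ?thesis unfolding eq[symmetric] by (simp add: nn_integral_completion)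
qed

text \<open>An infinite integral of the positive part must come from the tail, where the sign is constant.\<close>

lemma integral_at_top_if_nn_integral_infinite:
  fixes h :: "real \<Rightarrow> real"
  assumes cont: "continuous_on {v..} h" and inf: "(\<integral>\<^sup>+ t\<in>{v..}. ennreal (h t) \<partial>lebesgue) = \<infinity>"
    and sign: "(\<forall>t\<ge>T1. 0 \<le> h t) \<or> (\<forall>t\<ge>T1. h t \<le> 0)" and M: "v \<le> M" "T1 \<le> M"
  shows "filterlim (\<lambda>T. integral {M..T} h) at_top at_top" "\<exists>t\<ge>M. 0 < h t"
proof -
  define K where "K = integral {v..M} (\<lambda>t. max 0 (h t))"
  have int: "(\<lambda>t. max 0 (h t)) integrable_on {p..q}" "h integrable_on {p..q}" if "v \<le> p" for p q
    using that by (intro integrable_continuous_real continuous_intros continuous_on_subset[OF cont]; auto)+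
  have split: "integral {v..T} (\<lambda>t. max 0 (h t)) \<le> K + max 0 (integral {M..T} (\<lambda>t. max 0 (h t)))" if "v \<le> T" for T
  proof (cases "M \<le> T")
    case True
    then show ?thesis
      using Henstock_Kurzweil_Integration.integral_combine[OF M(1) True int(1)[OF order_refl]] K_def by simp
  next
    case False
    then have "integral {v..T} (\<lambda>t. max 0 (h t)) \<le> K"
      unfolding K_def by (intro integral_subset_le int) auto
    then show ?thesis by simp
  qed
  show pos: "\<exists>t\<ge>M. 0 < h t"
  proof (rule ccontr)
    assume neg: "\<not> (\<exists>t\<ge>M. 0 < h t)"
    have "integral {M..T} (\<lambda>t. max 0 (h t)) = integral {M..T} (\<lambda>t. 0)" for T
      using neg by (intro integral_cong) (auto simp: max_def not_less)
    then have "integral {v..T} (\<lambda>t. max 0 (h t)) \<le> K" if "v \<le> T" for T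
      using split[OF that] by simp
    from nn_integral_atLeast_finite[OF cont this] inf show False by simp
  qed
  then have nonneg: "0 \<le> h t" if "M \<le> t" for t
    using sign M(2) that by (metis linorder_not_le order_trans)
  have mono: "integral {M..S} h \<le> integral {M..T} h" if "S \<le> T" for S T
    using that nonneg M(1) by (intro integral_subset_le int) auto
  show "filterlim (\<lambda>T. integral {M..T} h) at_top at_top"
    unfolding filterlim_at_top
  proof (rule ccontr)
    assume "\<not> (\<forall>Z. \<forall>\<^sub>F T in at_top. Z \<le> integral {M..T} h)"
    then obtain Z where Z: "\<not> (\<forall>\<^sub>F T in at_top. Z \<le> integral {M..T} h)" by blast
    have lt: "integral {M..T} h \<le> Z" for T
    proof (rule ccontr)
      assume "\<not> integral {M..T} h \<le> Z"
      then have "\<forall>S\<ge>T. Z \<le> integral {M..S} h" using mono[of T] by force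
      then show False using Z unfolding eventually_at_top_linorder by blast
    qed
    have "integral {M..T} (\<lambda>t. max 0 (h t)) = integral {M..T} h" for T
      using nonneg by (intro integral_cong) (auto simp: max_def)
    then have "integral {v..T} (\<lambda>t. max 0 (h t)) \<le> K + max 0 Z" if "v \<le> T" for T
      using split[OF that] lt[of T] by (simp add: max_def split: if_splits)
    from nn_integral_atLeast_finite[OF cont this] inf show False by simp
  qed
qed

context tangent_domain
begin

text \<open>The exponential weights with base points \<open>u\<close> and \<open>v\<close> differ by a constant positive factor, so the divergence for one
  base point is the divergence for all.\<close>

lemma value_diverges:
  assumes f'_cont: "continuous_on UNIV f'" and sign: "\<exists>T. (\<forall>t\<ge>T. 0 \<le> f' t) \<or> (\<forall>t\<ge>T. f' t \<le> 0)"
    and inf: "(\<integral>\<^sup>+ t\<in>{v..}. ennreal (f' t * exp (integral {v..t} lam)) \<partial>lebesgue) = \<infinity>"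
  shows "\<exists>T. \<forall>t\<ge>T. 0 \<le> f' t"
    and "filterlim (\<lambda>T. integral {u..T} (\<lambda>t. f' t * exp (integral {u..t} lam))) at_top at_top"
proof -
  have lam_int_deriv: "((\<lambda>t. integral {r..t} lam) has_real_derivative lam t) (at t within {r..w})"
    if "r \<le> t" "t \<le> w" for r t w
    using that by (intro integral_has_real_derivative lam_cont) auto
  have "continuous_on {r..w} (\<lambda>t. integral {r..t} lam)" for r w
    by (rule DERIV_continuous_on, rule lam_int_deriv) auto
  then have exp_cont: "continuous_on {r..} (\<lambda>t. exp (integral {r..t} lam))" for r
    by (intro continuous_on_exp continuous_on_atLeast_if_Icc)
  let ?h = "\<lambda>r t. f' t * exp (integral {r..t} lam)"
  have h_cont: "continuous_on {r..} (?h r)" for r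
    by (intro continuous_intros exp_cont continuous_on_subset[OF f'_cont]) auto
  obtain T1 where T1: "(\<forall>t\<ge>T1. 0 \<le> f' t) \<or> (\<forall>t\<ge>T1. f' t \<le> 0)" using sign by blast
  then have T1': "(\<forall>t\<ge>T1. 0 \<le> ?h v t) \<or> (\<forall>t\<ge>T1. ?h v t \<le> 0)"
    by (simp add: zero_le_mult_iff mult_le_0_iff)
  define M where "M = max T1 (max u v)"
  have M: "v \<le> M" "T1 \<le> M" "u \<le> M" unfolding M_def by auto
  note tail = integral_at_top_if_nn_integral_infinite[OF h_cont inf T1' M(1,2)]
  show "\<exists>T. \<forall>t\<ge>T. 0 \<le> f' t"
    using T1 tail(2) M(2) by (metis exp_gt_zero order_trans zero_less_mult_pos2 linorder_not_le)
  define c where "c = exp (integral {u..max u v} lam - integral {v..max u v} lam)"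
  have shift: "?h u t = c * ?h v t" if "M \<le> t" for t
  proof -
    have "max u v \<le> t" using that unfolding M_def by simp
    have "exp (integral {u..t} lam) = c * exp (integral {v..t} lam)"
      unfolding integral_lam_shift[OF \<open>max u v \<le> t\<close>] c_def exp_add by (rule refl)
    then show ?thesis by simp
  qed
  have "filterlim (\<lambda>T. integral {u..M} (?h u) + c * integral {M..T} (?h v)) at_top at_top"
    by (intro filterlim_tendsto_add_at_top[OF tendsto_const] filterlim_tendsto_pos_mult_at_top[OF tendsto_const _ tail(1)])
       (simp add: c_def)
  moreover have "\<forall>\<^sub>F T in at_top. integral {u..M} (?h u) + c * integral {M..T} (?h v) = integral {u..T} (?h u)"
    using eventually_ge_at_top[of M]
  proof eventually_elim
    case (elim T)
    have "integral {u..M} (?h u) + integral {M..T} (?h u) = integral {u..T} (?h u)"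
      using M(3) elim
      by (intro Henstock_Kurzweil_Integration.integral_combine integrable_continuous_real continuous_on_subset[OF h_cont]) auto
    moreover have "integral {M..T} (?h u) = integral {M..T} (\<lambda>t. c * ?h v t)"
      using shift by (intro integral_cong) auto
    ultimately show ?case by simp
  qed
  ultimately show "filterlim (\<lambda>T. integral {u..T} (?h u)) at_top at_top"
    by (rule filterlim_cong[OF refl refl, THEN iffD1, rotated])
qed

text \<open>The point divides its left segment in the ratio \<open>\<theta> : 1 - \<theta>\<close>. Stopping the clock after the fraction \<open>\<theta>\<close> of the interval gives the
  test function this point as its average.\<close>

lemma exists_test_function:
  assumes "vanishing v" and f_deriv: "\<And>t. (f has_real_derivative f' t) (at t)" and f'_cont: "continuous_on UNIV f'"
    and sign: "\<exists>T. (\<forall>t\<ge>T. 0 \<le> f' t) \<or> (\<forall>t\<ge>T. f' t \<le> 0)"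
    and inf: "(\<integral>\<^sup>+ t\<in>{w..}. ennreal (f' t * exp (integral {w..t} lam)) \<partial>lebesgue) = \<infinity>"
    and pq: "(p, q) \<in> domain" "(p, q) \<notin> range (\<lambda>t. (x t, y t))" and "a < b"
  obtains \<tau> \<phi> where "\<And>s. \<phi> s = (x (\<tau> s), y (\<tau> s))" "\<phi> absolutely_integrable_on {a..b}"
    "\<And>c d. a \<le> c \<Longrightarrow> c < d \<Longrightarrow> d \<le> b \<Longrightarrow> average c d \<phi> \<in> domain" "average a b \<phi> = (p, q)"
    "ext_integral_exists {a..b} (\<lambda>s. f (\<tau> s))" "ext_integral {a..b} (\<lambda>s. f (\<tau> s)) = \<infinity>"
proof -
  obtain u where u: "x u < p" "p \<le> X (sL u)" "q = line u p" using domain_cases[OF pq] by blast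
  define \<theta> where "\<theta> = (p - x u) / (X (sL u) - x u)"
  have \<theta>: "0 < \<theta>" "\<theta> \<le> 1" "p = x u + \<theta> * (X (sL u) - x u)" using u unfolding \<theta>_def by auto
  interpret left_tangent_flow x y x' y' x'' y'' X Y X' Y' X'' Y'' u a "\<theta> * (b - a)"
    by unfold_locales (use vanishing_shift[OF assms(1)] \<theta>(1) \<open>a < b\<close> in auto)
  have late: "a + \<theta> * (b - a) \<le> b" using \<theta>(1,2) \<open>a < b\<close> mult_left_le_one_le[of "b - a" \<theta>] by argo
  obtain T where T: "\<And>t. T \<le> t \<Longrightarrow> 0 \<le> f' t" using value_diverges(1)[OF f'_cont sign inf] by blast
  have "Px b / (b - a) = p"
    unfolding primitive_late[OF late] \<theta>(3) using \<open>a < b\<close> by (simp add: field_simps)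
  moreover from this have "Py b / (b - a) = q"
    using initial_average(3)[OF \<open>a < b\<close>] clock_late[OF late] u(3) by simp
  ultimately have "average a b test_fun = (p, q)"
    using test_fun_average[OF order_refl \<open>a < b\<close>] by simp
  then show thesis
    using \<open>a < b\<close> test_fun_average average_in_domain
      ext_integral_comp_clock_infinite[OF f_deriv f'_cont T value_diverges(2)[OF f'_cont sign inf, of u, folded E_def] late]
    by (intro that[of test_fun clock] test_fun_def test_fun_absolutely_integrable) auto
qed

end

section \<open>Families of curves\<close>

lemma convex_curve_of_member:
  assumes "C31_smooth S G" "\<epsilon> \<in> S" "convex_graph_curve (G \<epsilon>)"
  shows "\<exists>x' y' x'' y''. convex_curve (\<lambda>t. fst (G \<epsilon> t)) (\<lambda>t. snd (G \<epsilon> t)) x' y' x'' y''"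
  using assms(1)[unfolded C31_smooth_def]
proof (elim exE conjE)
  fix D :: "nat \<Rightarrow> nat \<Rightarrow> real \<Rightarrow> real \<Rightarrow> real \<times> real"
  assume D': "\<forall>\<epsilon>\<in>S. \<forall>t. D 0 0 \<epsilon> t = G \<epsilon> t"
    "\<forall>i<3. \<forall>j\<le>1. \<forall>\<epsilon>\<in>S. \<forall>t. (D i j \<epsilon> has_vector_derivative D (Suc i) j \<epsilon> t) (at t)"
  have D0: "D 0 0 \<epsilon> t = G \<epsilon> t" for t
    using D'(1) assms(2) by blast
  have D: "(D i 0 \<epsilon> has_vector_derivative D (Suc i) 0 \<epsilon> t) (at t)" if "i < 3" for i t
    by (rule D'(2)[rule_format, OF that le0 assms(2)])
  have fst: "((\<lambda>t. fst (D i 0 \<epsilon> t)) has_real_derivative fst (D (Suc i) 0 \<epsilon> t)) (at t)"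
    and snd: "((\<lambda>t. snd (D i 0 \<epsilon> t)) has_real_derivative snd (D (Suc i) 0 \<epsilon> t)) (at t)" if "i < 3" for i t
    using bounded_linear.has_vector_derivative[OF bounded_linear_fst D[OF that]]
      bounded_linear.has_vector_derivative[OF bounded_linear_snd D[OF that]]
    by (simp_all add: has_real_derivative_iff_has_vector_derivative)
  have d: "deriv (\<lambda>t. fst (D i 0 \<epsilon> t)) = (\<lambda>t. fst (D (Suc i) 0 \<epsilon> t))"
    "deriv (\<lambda>t. snd (D i 0 \<epsilon> t)) = (\<lambda>t. snd (D (Suc i) 0 \<epsilon> t))" if "i < 3" for i
    by (intro ext DERIV_imp_deriv fst snd that)+
  have "convex_curve (\<lambda>t. fst (D 0 0 \<epsilon> t)) (\<lambda>t. snd (D 0 0 \<epsilon> t)) (\<lambda>t. fst (D (Suc 0) 0 \<epsilon> t)) (\<lambda>t. snd (D (Suc 0) 0 \<epsilon> t))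
     (\<lambda>t. fst (D (Suc (Suc 0)) 0 \<epsilon> t)) (\<lambda>t. snd (D (Suc (Suc 0)) 0 \<epsilon> t))"
  proof
    fix t
    have "D 0 0 \<epsilon> = G \<epsilon>" using D0 by (rule ext)
    then have conv: "convex_graph_curve (D 0 0 \<epsilon>)" using assms(3) by simp
    show "fst (D (Suc 0) 0 \<epsilon> t) > 0"
      "snd (D (Suc (Suc 0)) 0 \<epsilon> t) * fst (D (Suc 0) 0 \<epsilon> t) - snd (D (Suc 0) 0 \<epsilon> t) * fst (D (Suc (Suc 0)) 0 \<epsilon> t) > 0"
      using conv unfolding convex_graph_curve_def Let_def by (simp_all add: d)
    show "continuous_on UNIV (\<lambda>t. fst (D (Suc (Suc 0)) 0 \<epsilon> t))"
      by (rule continuous_on_if_DERIV, rule fst) simp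
    show "continuous_on UNIV (\<lambda>t. snd (D (Suc (Suc 0)) 0 \<epsilon> t))"
      by (rule continuous_on_if_DERIV, rule snd) simp
  qed (intro fst snd; simp)+
  then show ?thesis unfolding D0 by blast
qed

context tangent_domain
begin

context
  fixes G :: "real \<Rightarrow> real \<Rightarrow> real \<times> real" and \<epsilon> :: real
  assumes lower: "G 0 = (\<lambda>t. (x t, y t))" and upper: "G \<epsilon> = (\<lambda>t. (X t, Y t))"
begin

lemma tangency_params_eq: "tangency_params G \<epsilon> t = {s. up.tan_at s (x t) = y t}"
  unfolding tangency_params_def lower upper up.tangent_line_eq by auto

lemma s_eq: "s_L G \<epsilon> = sL" "s_R G \<epsilon> = sR"
  unfolding s_L_def s_R_def sL_def sR_def tangency_params_eq by auto

lemma w_eq: "w_L G \<epsilon> = (\<lambda>t. (X (sL t), Y (sL t)))" "w_R G \<epsilon> = (\<lambda>t. (X (sR t), Y (sR t)))"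
  unfolding w_L_def w_R_def s_eq upper by auto

lemma Omega_eq: "Omega G \<epsilon> = domain"
  unfolding Omega_def domain_def curv_triangle_def S_L_def S_R_def tangency_arc_def w_eq s_eq
  by (simp only: lower upper)

text \<open>The equation that defines \<open>\<lambda>\<close> has only one solution, because the contact point is not on the lower curve.\<close>

lemma lambda_L_eq: "lambda_L G \<epsilon> = lam"
proof
  fix t
  have "((\<lambda>t. (X (sL t), Y (sL t))) has_vector_derivative
      (lam t * (x t - X (sL t)), lam t * (y t - Y (sL t)))) (at t)"
    using contact_x_deriv contact_y_deriv unfolding has_real_derivative_iff_has_vector_derivative
    by (rule has_vector_derivative_Pair)
  then have "vector_derivative (w_L G \<epsilon>) (at t) = lam t *\<^sub>R (G 0 t - w_L G \<epsilon> t)"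
    unfolding w_eq lower by (simp add: vector_derivative_at)
  moreover have "G 0 t - w_L G \<epsilon> t \<noteq> 0"
    unfolding w_eq lower using contact_sides(2)[of t] by (simp add: zero_prod_def)
  ultimately show "lambda_L G \<epsilon> t = lam t"
    unfolding lambda_L_def by (intro the_equality) (auto dest: scaleR_right_imp_eq)
qed

end
end

text \<open>The upper curve lies in the closure of its epigraph, which is contained in the closure of the
  lower epigraph and avoids the lower curve: so it runs strictly above the lower curve, over the same abscissas.\<close>

lemma tangent_domain_of_admissible:
  assumes adm: "admissible_family \<epsilon>max G" and eps: "0 < \<epsilon>" "ereal \<epsilon> < \<epsilon>max"
  shows "\<exists>x' y' x'' y'' X' Y' X'' Y''. tangent_domain (\<lambda>t. fst (G 0 t)) (\<lambda>t. snd (G 0 t)) x' y' x'' y''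
      (\<lambda>t. fst (G \<epsilon> t)) (\<lambda>t. snd (G \<epsilon> t)) X' Y' X'' Y''"
proof -
  have E: "0 \<in> eps_range \<epsilon>max" "\<epsilon> \<in> eps_range \<epsilon>max"
    using eps less_trans[of "ereal 0" "ereal \<epsilon>" \<epsilon>max] unfolding eps_range_def by (auto simp: zero_ereal_def)
  have adm': "C31_smooth (eps_range \<epsilon>max) G" "\<And>\<epsilon>. \<epsilon> \<in> eps_range \<epsilon>max \<Longrightarrow> convex_graph_curve (G \<epsilon>)"
    "Xi G \<epsilon> \<subseteq> Xi G 0" "\<And>t. G 0 t \<notin> closure (Xi G \<epsilon>)"
    "\<And>t. card (tangency_params G \<epsilon> t) = 2"
    "\<And>t s. s \<in> tangency_params G \<epsilon> t \<Longrightarrow> card (tangent_line (G \<epsilon>) s \<inter> range (G 0)) = 2"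
    using adm eps E unfolding admissible_family_def by blast+
  obtain x' y' x'' y'' where low: "convex_curve (\<lambda>t. fst (G 0 t)) (\<lambda>t. snd (G 0 t)) x' y' x'' y''"
    using convex_curve_of_member[OF adm'(1) E(1) adm'(2)[OF E(1)]] by blast
  obtain X' Y' X'' Y'' where up: "convex_curve (\<lambda>t. fst (G \<epsilon> t)) (\<lambda>t. snd (G \<epsilon> t)) X' Y' X'' Y''"
    using convex_curve_of_member[OF adm'(1) E(2) adm'(2)[OF E(2)]] by blast
  interpret low: convex_curve "\<lambda>t. fst (G 0 t)" "\<lambda>t. snd (G 0 t)" x' y' x'' y'' by (rule low)
  interpret up: convex_curve "\<lambda>t. fst (G \<epsilon> t)" "\<lambda>t. snd (G \<epsilon> t)" X' Y' X'' Y'' by (rule up)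
  have line: "z \<in> tangent_line (G \<epsilon>) s \<longleftrightarrow> snd z = up.tan_at s (fst z)" for z s
    using up.tangent_line_eq[of "fst z" "snd z" s] by simp
  have params: "tangency_params G \<epsilon> t = {s. up.tan_at s (fst (G 0 t)) = snd (G 0 t)}" for t
    unfolding tangency_params_def line by auto
  have "tangent_domain (\<lambda>t. fst (G 0 t)) (\<lambda>t. snd (G 0 t)) x' y' x'' y''
      (\<lambda>t. fst (G \<epsilon> t)) (\<lambda>t. snd (G \<epsilon> t)) X' Y' X'' Y''"
  proof
    fix s
    have "(fst (G \<epsilon> s), snd (G \<epsilon> s) + r) \<in> Xi G \<epsilon>" if "0 < r" for r
      using that unfolding Xi_def by force
    then have in_Xi: "(fst (G \<epsilon> s), snd (G \<epsilon> s) + r) \<in> Xi G \<epsilon>" "(fst (G \<epsilon> s), snd (G \<epsilon> s) + r) \<in> Xi G 0" if "0 < r" for r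
      using that adm'(3) by blast+
    from in_Xi(2)[of 1] obtain t where t: "fst (G 0 t) = fst (G \<epsilon> s)" unfolding Xi_def by auto
    \<comment> \<open>Points just above the upper curve lie in the lower epigraph, which gives the weak inequality; equality would put
      the point of the lower curve into the closure of the upper epigraph.\<close>
    have le: "snd (G 0 t) \<le> snd (G \<epsilon> s)"
    proof (rule field_le_epsilon)
      fix r :: real assume "0 < r"
      from in_Xi(2)[OF this] obtain v where "fst (G 0 v) = fst (G \<epsilon> s)" "snd (G 0 v) < snd (G \<epsilon> s) + r"
        unfolding Xi_def by auto
      then show "snd (G 0 t) \<le> snd (G \<epsilon> s) + r" using t low.x_eq_iff[of v t] by simp
    qed
    have "(\<lambda>n. (fst (G \<epsilon> s), snd (G \<epsilon> s) + inverse (real (Suc n)))) \<longlonglongrightarrow> (fst (G \<epsilon> s), snd (G \<epsilon> s) + 0)"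
      by (intro tendsto_intros LIMSEQ_inverse_real_of_nat)
    then have "G \<epsilon> s \<in> closure (Xi G \<epsilon>)"
      unfolding closure_sequential using in_Xi(1)
      by (intro exI[of _ "\<lambda>n. (fst (G \<epsilon> s), snd (G \<epsilon> s) + inverse (real (Suc n)))"]) simp
    then have "G 0 t \<noteq> G \<epsilon> s" using adm'(4) by metis
    then show "\<exists>t. fst (G 0 t) = fst (G \<epsilon> s) \<and> snd (G 0 t) < snd (G \<epsilon> s)"
      using t le by (metis order_le_less prod_eqI)
  next
    fix t show "card {s. up.tan_at s (fst (G 0 t)) = snd (G 0 t)} = 2"
      using adm'(5)[of t] unfolding params .
  next
    fix s t assume *: "up.tan_at s (fst (G 0 t)) = snd (G 0 t)"
    then have "card (tangent_line (G \<epsilon>) s \<inter> range (G 0)) = 2"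
      by (intro adm'(6)[of _ t]) (simp add: params)
    then have "\<not> tangent_line (G \<epsilon>) s \<inter> range (G 0) \<subseteq> {G 0 t}"
      using card_mono[of "{G 0 t}" "tangent_line (G \<epsilon>) s \<inter> range (G 0)"] by auto
    then obtain t' where "G 0 t' \<in> tangent_line (G \<epsilon>) s" "G 0 t' \<noteq> G 0 t" by blast
    then show "\<exists>t'. t' \<noteq> t \<and> up.tan_at s (fst (G 0 t')) = snd (G 0 t')"
      unfolding line by metis
  qed
  then show ?thesis by blast
qed

theorem proposition5p2p8:
  fixes \<epsilon>max :: ereal and G :: "real \<Rightarrow> real \<Rightarrow> real \<times> real"
    and \<epsilon> t0 :: real and f :: "real \<Rightarrow> real"
  assumes "admissible_family \<epsilon>max G"
    and "0 < \<epsilon>" and "ereal \<epsilon> < \<epsilon>max"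
    and "regular_function (G 0) f"
    and "((\<lambda>t. (1 + norm (w_L G \<epsilon> t - G 0 t)) * exp (integral {t0..t} (lambda_L G \<epsilon>)))
            \<longlongrightarrow> 0) at_top"
    and "\<not> (\<forall>v. ext_integral {v..}
                (\<lambda>\<tau>. deriv f \<tau> * exp (integral {v..\<tau>} (lambda_L G \<epsilon>))) < \<infinity>)"
  shows "\<forall>x \<in> Omega G \<epsilon> - fixed_bdry G. \<forall>a b. a < b \<longrightarrow> Bellman G \<epsilon> f a b x = \<infinity>"
proof (intro ballI allI impI)
  fix z and a b :: real
  assume z: "z \<in> Omega G \<epsilon> - fixed_bdry G" and "a < b"
  obtain x' y' x'' y'' X' Y' X'' Y'' where td: "tangent_domain (\<lambda>t. fst (G 0 t)) (\<lambda>t. snd (G 0 t)) x' y' x'' y''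
      (\<lambda>t. fst (G \<epsilon> t)) (\<lambda>t. snd (G \<epsilon> t)) X' Y' X'' Y''"
    using tangent_domain_of_admissible[OF assms(1-3)] by blast
  interpret tangent_domain "\<lambda>t. fst (G 0 t)" "\<lambda>t. snd (G 0 t)" x' y' x'' y''
      "\<lambda>t. fst (G \<epsilon> t)" "\<lambda>t. snd (G \<epsilon> t)" X' Y' X'' Y''
    by (rule td)
  have curves: "G 0 = (\<lambda>t. (fst (G 0 t), snd (G 0 t)))" "G \<epsilon> = (\<lambda>t. (fst (G \<epsilon> t), snd (G \<epsilon> t)))"
    by simp_all
  note Omega = Omega_eq[OF curves] and lambda = lambda_L_eq[OF curves] and w = w_eq(1)[OF curves]
  have "vanishing t0"
    using assms(5) unfolding vanishing_def lambda w by simp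
  obtain f' where f'_deriv: "\<And>t. (f has_real_derivative f' t) (at t)"
    using assms(4) unfolding regular_function_def C1_differentiable_on_def
    by (auto simp: has_real_derivative_iff_has_vector_derivative)
  then have deriv_f: "deriv f = f'" by (auto intro: DERIV_imp_deriv)
  obtain f'' where f''_deriv: "\<And>t. (f' has_real_derivative f'' t) (at t)"
    using assms(4) unfolding regular_function_def C1_differentiable_on_def deriv_f
    by (auto simp: has_real_derivative_iff_has_vector_derivative)
  have f'_cont: "continuous_on UNIV f'" using f''_deriv by (rule continuous_on_if_DERIV)
  have d1: "deriv (\<lambda>t. fst (G 0 t)) = x'" "deriv (\<lambda>t. snd (G 0 t)) = y'"
    by (auto intro: DERIV_imp_deriv low.x_deriv low.y_deriv)
  have d2: "deriv (\<lambda>t. y' t / x' t) = low.slope_at'"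
    using low.slope_at_deriv by (auto intro: DERIV_imp_deriv simp: low.slope_at_def[abs_def])
  have "piecewise_monotone (\<lambda>t. deriv (\<lambda>t. f' t / x' t) t / low.slope_at' t)"
    using assms(4) unfolding regular_function_def Let_def deriv_f d1 d2 by blast
  note sign = low.regular_eventually_sign[OF f''_deriv this]
  obtain v where v: "\<not> ext_integral {v..} (\<lambda>t. f' t * exp (integral {v..t} lam)) < \<infinity>"
    using assms(6) unfolding deriv_f lambda by blast
  have inf: "(\<integral>\<^sup>+ t\<in>{v..}. ennreal (f' t * exp (integral {v..t} lam)) \<partial>lebesgue) = \<infinity>" (is "?I = _")
  proof (rule ccontr)
    assume "?I \<noteq> \<infinity>"
    then have "enn2ereal ?I < \<infinity>" by (cases ?I) auto
    moreover have "enn2ereal ?I - enn2ereal r \<le> enn2ereal ?I" for r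
      using enn2ereal_nonneg[of r] by (rule ereal_diff_le_self)
    ultimately show False
      using v unfolding ext_integral_def by (blast intro: le_less_trans)
  qed
  obtain p q where pq: "z = (p, q)" by (cases z)
  have "(p, q) \<in> domain" "(p, q) \<notin> range (\<lambda>t. (fst (G 0 t), snd (G 0 t)))"
    using z unfolding pq Omega fixed_bdry_def by auto
  then show "Bellman G \<epsilon> f a b z = \<infinity>"
  proof (rule exists_test_function[OF \<open>vanishing t0\<close> f'_deriv f'_cont sign inf _ _ \<open>a < b\<close>])
    fix \<tau> \<phi>
    assume \<phi>: "\<And>s. \<phi> s = (fst (G 0 (\<tau> s)), snd (G 0 (\<tau> s)))" "\<phi> absolutely_integrable_on {a..b}"
      "\<And>c d. a \<le> c \<Longrightarrow> c < d \<Longrightarrow> d \<le> b \<Longrightarrow> average c d \<phi> \<in> domain" "average a b \<phi> = (p, q)"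
      "ext_integral_exists {a..b} (\<lambda>s. f (\<tau> s))" "ext_integral {a..b} (\<lambda>s. f (\<tau> s)) = \<infinity>"
    have \<phi>_G: "\<phi> s = G 0 (\<tau> s)" for s using \<phi>(1) by simp
    have "inj (G 0)" by (rule injI) (metis low.x_eq_iff)
    then have bdry: "bdry_fun (G 0) f (\<phi> s) = f (\<tau> s)" for s
      unfolding bdry_fun_def \<phi>_G by simp
    have "\<phi> \<in> A_class G \<epsilon> a b"
      unfolding A_class_def Omega fixed_bdry_def using \<phi>(2,3) \<phi>_G by auto
    then have "ext_integral {a..b} (\<lambda>s. bdry_fun (G 0) f (\<phi> s)) / ereal (b - a) \<le> Bellman G \<epsilon> f a b z"
      unfolding Bellman_def using \<phi>(4,5) pq bdry by (intro Sup_upper CollectI exI[of _ \<phi>]) simp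
    then show ?thesis
      using \<phi>(6) \<open>a < b\<close> unfolding bdry by simp
  qed
qed

end
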